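(* Let $\mathcal H$ be a complex Hilbert space and let $\mathcal L$ be a commutative and completely distributive subspace lattice on $\mathcal H$ (in particular, $\mathcal L$ may be a nest). Put $\mathcal A=\mathrm{Alg}\,\mathcal L$. Then for every $\sigma$-weakly closed right $\mathcal A$-submodule $\mathcal U$ of $\mathcal B(\mathcal H)$ there exists $\phi\in\mathrm{Hom}(\mathrm{Lat}\,\mathcal A,\mathcal P)$ such that $\mathcal U=\{T\in\mathcal B(\mathcal H): TE\subseteq\phi(E)\ \text{for all } E\in\mathrm{Lat}\,\mathcal A\}$, and for every $\sigma$-weakly closed left $\mathcal A$-submodule $\mathcal U$ of $\mathcal B(\mathcal H)$ there exists $\psi\in\mathrm{Hom}(\mathrm{Lat}\,\mathcal A,\mathcal P)$ such that $\mathcal U=\{T\in\mathcal B(\mathcal H): T\psi(E)\subseteq E\ \text{for all } E\in\mathrm{Lat}\,\mathcal A\}$.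
   Context: $\mathcal B(\mathcal H)$ is the algebra of bounded linear operators on $\mathcal H$, and $\mathcal P$ is the complete lattice of all orthogonal projections in $\mathcal B(\mathcal H)$. Projections are identified with their ranges; $TE\subseteq F$ means that $T$ maps the range of $E$ into the range of $F$. A subspace lattice is a complete sublattice of $\mathcal P$ containing $0$ and $I$; it is commutative if its projections commute pairwise, and it is a nest if it is totally ordered. $\mathrm{Alg}\,\mathcal L$ is the algebra of all $T\in\mathcal B(\mathcal H)$ with $TE\subseteq E$ for all $E\in\mathcal L$. $\mathrm{Lat}\,\mathcal A$ is the complete lattice of projections invariant under every element of $\mathcal A$. $\mathrm{Hom}(\mathrm{Lat}\,\mathcal A,\mathcal P)$ is the set of order homomorphisms (maps $\phi$ with $E\le F\Rightarrow\phi(E)\le\phi(F)$) from $\mathrm{Lat}\,\mathcal A$ into $\mathcal P$. A right (left) $\mathcal A$-submodule is a linear subspace $\mathcal U\subseteq\mathcal B(\mathcal H)$ with $\mathcal U\mathcal A\subseteq\mathcal U$ ($\mathcal A\,\mathcal U\subseteq\mathcal U$). *)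

theory Defs
  imports "HOL-Analysis.Analysis"
begin

section \<open>Complex Hilbert spaces\<close>

text \<open>
  The real Hilbert space structure on \<open>'a\<close> (inner product, norm, topology) is the one induced by the
  complex inner product: \<open>inner x y = Re \<langle>x, y\<rangle>\<close>, so that \<open>\<parallel>x\<parallel> = sqrt \<langle>x, x\<rangle>\<close>. The inner product is
  linear in the first and conjugate linear in the second argument. No separability and no
  restriction on the dimension is imposed.
\<close>

class complex_hilbert = real_inner + banach +
  fixes scaleC :: "complex \<Rightarrow> 'a \<Rightarrow> 'a" (infixr "*\<^sub>C" 75)
    and cinner :: "'a \<Rightarrow> 'a \<Rightarrow> complex"
  assumes scaleR_scaleC: "scaleR r x = complex_of_real r *\<^sub>C x"
    and scaleC_add_right: "c *\<^sub>C (x + y) = c *\<^sub>C x + c *\<^sub>C y"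
    and scaleC_add_left: "(c + d) *\<^sub>C x = c *\<^sub>C x + d *\<^sub>C x"
    and scaleC_scaleC: "c *\<^sub>C (d *\<^sub>C x) = (c * d) *\<^sub>C x"
    and cinner_commute: "cinner x y = cnj (cinner y x)"
    and cinner_add_left: "cinner (x + y) z = cinner x z + cinner y z"
    and cinner_scaleC_left: "cinner (c *\<^sub>C x) y = c * cinner x y"
    and inner_eq_Re_cinner: "inner x y = Re (cinner x y)"

instantiation complex :: complex_hilbert
begin
definition scaleC_complex :: "complex \<Rightarrow> complex \<Rightarrow> complex" where
  "scaleC_complex c x = c * x"
definition cinner_complex :: "complex \<Rightarrow> complex \<Rightarrow> complex" where
  "cinner_complex x y = x * cnj y"
instance
  by standard
    (simp_all add: scaleC_complex_def cinner_complex_def scaleR_conv_of_real algebra_simps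
      inner_complex_def)
end

lemma scaleC_one [simp]: "1 *\<^sub>C x = (x::'a::complex_hilbert)"
  using scaleR_scaleC[of 1 x] by simp

lemma scaleC_zero_right [simp]: "c *\<^sub>C 0 = (0::'a::complex_hilbert)"
  using scaleC_add_right[of c 0 0] by simp

lemma cinner_add_right: "cinner x (y + z) = cinner x y + cinner x (z::'a::complex_hilbert)"
  by (metis cinner_add_left cinner_commute complex_cnj_add)

lemma cinner_scaleC_right: "cinner x (c *\<^sub>C y) = cnj c * cinner x (y::'a::complex_hilbert)"
  by (metis cinner_commute cinner_scaleC_left complex_cnj_mult)

lemma cinner_zero_left [simp]: "cinner 0 y = 0" for y :: "'a::complex_hilbert"
  using cinner_add_left[of 0 0 y] by simp

lemma cinner_zero_right [simp]: "cinner x 0 = 0" for x :: "'a::complex_hilbert"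
  using cinner_add_right[of x 0 0] by simp

lemma cinner_diff_left: "cinner (x - y) z = cinner x z - cinner y (z::'a::complex_hilbert)"
  using cinner_add_left[of "x - y" y z] by simp

lemma cinner_diff_right: "cinner x (y - z) = cinner x y - cinner x (z::'a::complex_hilbert)"
  using cinner_add_right[of x "y - z" z] by simp

lemma cinner_self: "cinner x x = complex_of_real ((norm x)\<^sup>2)" for x :: "'a::complex_hilbert"
proof -
  have "Im (cinner x x) = 0"
    using arg_cong[OF cinner_commute[of x x], of Im] by simp
  then show ?thesis
    by (simp add: complex_eq_iff power2_norm_eq_inner inner_eq_Re_cinner)
qed

lemma norm_scaleC: "norm (c *\<^sub>C x) = cmod c * norm (x::'a::complex_hilbert)"
proof -
  have "complex_of_real ((norm (c *\<^sub>C x))\<^sup>2) = complex_of_real ((cmod c * norm x)\<^sup>2)"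
    unfolding cinner_self[symmetric] cinner_scaleC_left cinner_scaleC_right
    by (simp add: cinner_self power_mult_distrib complex_norm_square[of c] mult.assoc
        del: of_real_power flip: of_real_power)
  then have "(norm (c *\<^sub>C x))\<^sup>2 = (cmod c * norm x)\<^sup>2"
    using of_real_eq_iff by blast
  then show ?thesis
    by (simp add: power2_eq_iff_nonneg)
qed

lemma bounded_linear_scaleC: "bounded_linear (\<lambda>x. c *\<^sub>C (x::'a::complex_hilbert))"
  by (rule bounded_linear_intro[where K = "cmod c"])
    (simp_all add: scaleC_add_right scaleR_scaleC scaleC_scaleC mult.commute norm_scaleC)


section \<open>Bounded operators\<close>

text \<open>
  The library type \<open>'a \<Rightarrow>\<^sub>L 'a\<close> consists of the bounded \<^emph>\<open>real\<close>-linear operators; \<open>\<B>(\<H>)\<close> is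
  its subset of complex-linear ones.
\<close>

definition BH :: "('a::complex_hilbert \<Rightarrow>\<^sub>L 'a) set" where
  "BH = {T. \<forall>c x. blinfun_apply T (c *\<^sub>C x) = c *\<^sub>C blinfun_apply T x}"

definition op_scaleC :: "complex \<Rightarrow> ('a::complex_hilbert \<Rightarrow>\<^sub>L 'a) \<Rightarrow> ('a \<Rightarrow>\<^sub>L 'a)" where
  "op_scaleC c T = Blinfun (\<lambda>x. c *\<^sub>C blinfun_apply T x)"

lemma op_scaleC_apply [simp]: "blinfun_apply (op_scaleC c T) x = c *\<^sub>C blinfun_apply T x"
  unfolding op_scaleC_def
  by (subst bounded_linear_Blinfun_apply)
    (auto intro: bounded_linear_compose[OF bounded_linear_scaleC] blinfun.bounded_linear_right)

text \<open>
  The \<open>\<sigma>\<close>-weak (ultraweak) topology on \<open>\<B>(\<H>)\<close>: the coarsest topology making all functionals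
  \<open>T \<mapsto> \<Sum>n. \<langle>T x\<^sub>n, y\<^sub>n\<rangle>\<close> with \<open>\<Sum>n. \<parallel>x\<^sub>n\<parallel>\<^sup>2 < \<infinity>\<close> and \<open>\<Sum>n. \<parallel>y\<^sub>n\<parallel>\<^sup>2 < \<infinity>\<close> continuous. (For such sequences the
  series converges absolutely.)
\<close>

definition sigma_weak :: "('a::complex_hilbert \<Rightarrow>\<^sub>L 'a) topology" where
  "sigma_weak = topology_generated_by
     {{T \<in> BH. (\<Sum>n. cinner (blinfun_apply T (x n)) (y n)) \<in> V} | x y V.
        summable (\<lambda>n. (norm (x n))\<^sup>2) \<and> summable (\<lambda>n. (norm (y n))\<^sup>2) \<and> open V}"

lemma topspace_sigma_weak: "topspace sigma_weak = (BH :: ('a::complex_hilbert \<Rightarrow>\<^sub>L 'a) set)"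
proof -
  let ?B = "{{T \<in> BH. (\<Sum>n. cinner (blinfun_apply T (x n)) (y n)) \<in> V} | x y V.
        summable (\<lambda>n. (norm (x n :: 'a))\<^sup>2) \<and> summable (\<lambda>n. (norm (y n :: 'a))\<^sup>2) \<and> open V}"
  have "BH \<in> ?B"
    by (rule CollectI, rule exI[of _ "\<lambda>_. 0"], rule exI[of _ "\<lambda>_. 0"], rule exI[of _ UNIV]) simp
  then have "BH \<subseteq> \<Union>?B"
    by (rule Union_upper)
  moreover have "\<Union>?B \<subseteq> BH"
    by (rule Union_least) auto
  ultimately show ?thesis
    unfolding sigma_weak_def topology_generated_by_topspace by (intro subset_antisym)
qed


section \<open>The lattice of orthogonal projections\<close>

typedef (overloaded) 'a proj =
  "{P :: 'a::complex_hilbert \<Rightarrow>\<^sub>L 'a. P \<in> BH \<and> P o\<^sub>L P = P \<and>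
      (\<forall>x y. cinner (blinfun_apply P x) y = cinner x (blinfun_apply P y))}"
  morphisms proj_op Abs_proj
  by (rule exI[of _ 0]) (auto simp: BH_def intro!: blinfun_eqI)

definition prange :: "'a::complex_hilbert proj \<Rightarrow> 'a set" where
  "prange E = range (blinfun_apply (proj_op E))"

lemma proj_op_BH: "proj_op E \<in> BH"
  using proj_op[of E] by simp

lemma proj_op_scaleC: "blinfun_apply (proj_op E) (c *\<^sub>C x) = c *\<^sub>C blinfun_apply (proj_op E) x"
  using proj_op_BH[of E] by (simp add: BH_def)

lemma proj_op_idem [simp]:
  "blinfun_apply (proj_op E) (blinfun_apply (proj_op E) x) = blinfun_apply (proj_op E) x"
proof -
  have "proj_op E o\<^sub>L proj_op E = proj_op E"
    using proj_op[of E] by simp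
  then show ?thesis
    by (metis blinfun_apply_blinfun_compose)
qed

lemma proj_op_selfadjoint:
  "cinner (blinfun_apply (proj_op E) x) y = cinner x (blinfun_apply (proj_op E) y)"
  using proj_op[of E] by simp

lemma mem_prange_iff: "x \<in> prange E \<longleftrightarrow> blinfun_apply (proj_op E) x = x"
proof
  assume "x \<in> prange E"
  then obtain z where "x = blinfun_apply (proj_op E) z"
    unfolding prange_def by blast
  then show "blinfun_apply (proj_op E) x = x" by simp
next
  assume "blinfun_apply (proj_op E) x = x"
  then show "x \<in> prange E"
    unfolding prange_def by (intro range_eqI[of x _ x]) simp
qed

lemma proj_op_mem_prange [simp]: "blinfun_apply (proj_op E) x \<in> prange E"
  by (simp add: prange_def)

lemma prange_eqD:
  assumes "prange E = prange F"
  shows "E = F"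
proof -
  have "blinfun_apply (proj_op E) x = blinfun_apply (proj_op F) x" for x
  proof -
    let ?e = "blinfun_apply (proj_op E)" and ?f = "blinfun_apply (proj_op F)"
    have fe: "?f (?e z) = ?e z" and ef: "?e (?f z) = ?f z" for z
      using proj_op_mem_prange[of E z, unfolded assms] proj_op_mem_prange[of F z, folded assms]
      unfolding mem_prange_iff .
    have "cinner (?e x - ?f x) (?e x - ?f x) = 0"
      unfolding cinner_diff_left cinner_diff_right
        proj_op_selfadjoint[of E x] proj_op_selfadjoint[of F x] by (simp add: fe ef)
    then show ?thesis
      by (simp add: cinner_self)
  qed
  then have "proj_op E = proj_op F"
    by (rule blinfun_eqI)
  then show ?thesis
    by (simp add: proj_op_inject)
qed

definition closed_csubspace :: "'a::complex_hilbert set \<Rightarrow> bool" where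
  "closed_csubspace M \<longleftrightarrow> closed M \<and> 0 \<in> M \<and> (\<forall>x\<in>M. \<forall>y\<in>M. x + y \<in> M) \<and> (\<forall>c. \<forall>x\<in>M. c *\<^sub>C x \<in> M)"

lemma closed_csubspace_prange: "closed_csubspace (prange E)"
proof -
  have "prange E = {x. blinfun_apply (proj_op E) x = x}"
    by (auto simp: mem_prange_iff)
  moreover have "closed {x. blinfun_apply (proj_op E) x = x}"
    by (intro closed_Collect_eq blinfun.continuous_on continuous_on_id continuous_on_const)
  ultimately show ?thesis
    by (auto simp: closed_csubspace_def blinfun.add_right proj_op_scaleC)
qed

lemma closed_csubspace_Inter: "(\<And>E. E \<in> S \<Longrightarrow> closed_csubspace (M E)) \<Longrightarrow> closed_csubspace (\<Inter>E\<in>S. M E)"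
  unfolding closed_csubspace_def by (auto intro!: closed_INT)

lemma nearest_point:
  fixes x :: "'a::complex_hilbert"
  assumes M: "closed_csubspace M"
  shows "\<exists>m\<in>M. \<forall>z\<in>M. cinner (x - m) z = 0"
proof -
  have M0: "0 \<in> M" and Madd: "\<And>a b. a \<in> M \<Longrightarrow> b \<in> M \<Longrightarrow> a + b \<in> M"
    and MC: "\<And>c a. a \<in> M \<Longrightarrow> c *\<^sub>C a \<in> M" and Mcl: "closed M"
    using M by (auto simp: closed_csubspace_def)
  have MR: "r *\<^sub>R a \<in> M" if "a \<in> M" for r a
    using MC[OF that] by (simp add: scaleR_scaleC)
  define g where "g m = (norm (x - m))\<^sup>2" for m
  define d where "d = Inf (g ` M)"
  have bdd: "bdd_below (g ` M)"
    by (rule bdd_belowI[of _ 0]) (auto simp: g_def)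
  have dle: "d \<le> g m" if "m \<in> M" for m
    unfolding d_def using that bdd by (intro cInf_lower) auto
  have "\<exists>m\<in>M. g m < d + inverse (real (Suc n))" for n
  proof -
    have "Inf (g ` M) < d + inverse (real (Suc n))"
      unfolding d_def by simp
    then show ?thesis
      using cInf_less_iff[of "g ` M"] M0 bdd by auto
  qed
  then obtain f where fM: "\<And>n. f n \<in> M" and fg: "\<And>n. g (f n) < d + inverse (real (Suc n))"
    by metis
  have par: "(norm (a - b))\<^sup>2 \<le> 2 * (g a - d) + 2 * (g b - d)" if "a \<in> M" "b \<in> M" for a b
  proof -
    have "(norm (a - b))\<^sup>2 = 2 * g a + 2 * g b - 4 * g ((1/2) *\<^sub>R (a + b))"
      unfolding g_def power2_norm_eq_inner
      by (simp add: inner_diff_left inner_diff_right inner_add_left inner_add_right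
          inner_commute algebra_simps)
    moreover have "d \<le> g ((1/2) *\<^sub>R (a + b))"
      using that by (intro dle MR Madd)
    ultimately show ?thesis by simp
  qed
  have "Cauchy f"
  proof (rule metric_CauchyI)
    fix e :: real assume e: "0 < e"
    obtain N where N: "inverse (real (Suc N)) < e\<^sup>2 / 4"
      using reals_Archimedean[of "e\<^sup>2 / 4"] e by auto
    have "dist (f m) (f n) < e" if "m \<ge> N" "n \<ge> N" for m n
    proof -
      have "inverse (real (Suc m)) \<le> inverse (real (Suc N))"
        "inverse (real (Suc n)) \<le> inverse (real (Suc N))"
        using that by (auto intro!: le_imp_inverse_le)
      then have "g (f m) - d < e\<^sup>2 / 4" "g (f n) - d < e\<^sup>2 / 4"
        using fg[of m] fg[of n] N by linarith+
      then have "(norm (f m - f n))\<^sup>2 < e\<^sup>2"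
        using par[OF fM fM, of m n] by argo
      then show ?thesis
        using e by (simp add: dist_norm power_less_imp_less_base)
    qed
    then show "\<exists>N. \<forall>m\<ge>N. \<forall>n\<ge>N. dist (f m) (f n) < e" by blast
  qed
  then obtain m where lim: "f \<longlonglongrightarrow> m"
    by (auto simp: Cauchy_convergent_iff convergent_def)
  have mM: "m \<in> M"
    using closed_sequentially[OF Mcl _ lim] fM by blast
  have "(\<lambda>n. g (f n)) \<longlonglongrightarrow> g m"
    unfolding g_def by (intro tendsto_intros lim)
  moreover have "(\<lambda>n. d + inverse (real (Suc n))) \<longlonglongrightarrow> d + 0"
    by (intro tendsto_intros LIMSEQ_inverse_real_of_nat)
  ultimately have gm: "g m \<le> d"
    using fg by (intro LIMSEQ_le[of "\<lambda>n. g (f n)" _ "\<lambda>n. d + inverse (real (Suc n))"])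
      (auto intro!: exI[of _ 0] less_imp_le)
  have orth: "inner (x - m) z = 0" if z: "z \<in> M" for z
  proof (cases "z = 0")
    case False
    define t where "t = inner (x - m) z / inner z z"
    have zz: "inner z z > 0"
      using False by simp
    have "g m \<le> g (m + t *\<^sub>R z)"
      using gm dle[OF Madd[OF mM MR[OF z, of t]]] by linarith
    also have "g (m + t *\<^sub>R z) = g m - 2 * t * inner (x - m) z + t * t * inner z z"
      unfolding g_def power2_norm_eq_inner
      by (simp add: inner_diff_left inner_diff_right inner_add_left inner_add_right
          inner_commute algebra_simps)
    also have "\<dots> = g m - (inner (x - m) z)\<^sup>2 / inner z z"
      using zz by (simp add: t_def field_simps power2_eq_square)
    finally have "(inner (x - m) z)\<^sup>2 / inner z z \<le> 0" by simp
    then show ?thesis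
      using zz by (simp add: divide_le_0_iff power2_less_eq_zero_iff)
  qed simp
  have "cinner (x - m) z = 0" if z: "z \<in> M" for z
  proof (rule complex_eqI)
    show "Re (cinner (x - m) z) = Re 0"
      using orth[OF z] by (simp add: inner_eq_Re_cinner)
    have "Re (cinner (x - m) (\<i> *\<^sub>C z)) = 0"
      using orth[OF MC[OF z]] by (simp add: inner_eq_Re_cinner)
    then show "Im (cinner (x - m) z) = Im 0"
      by (simp add: cinner_scaleC_right)
  qed
  then show ?thesis using mM by blast
qed

lemma ex_proj_onto:
  fixes M :: "'a::complex_hilbert set"
  assumes M: "closed_csubspace M"
  shows "\<exists>E. prange E = M"
proof -
  have M0: "0 \<in> M" and Madd: "\<And>a b. a \<in> M \<Longrightarrow> b \<in> M \<Longrightarrow> a + b \<in> M"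
    and MC: "\<And>c a. a \<in> M \<Longrightarrow> c *\<^sub>C a \<in> M"
    using M by (auto simp: closed_csubspace_def)
  have MR: "r *\<^sub>R a \<in> M" if "a \<in> M" for r a
    using MC[OF that] by (simp add: scaleR_scaleC)
  have Mdiff: "a - b \<in> M" if "a \<in> M" "b \<in> M" for a b
    using Madd[OF that(1) MR[OF that(2), of "-1"]] by simp
  obtain p where pM: "\<And>x. p x \<in> M" and po: "\<And>x z. z \<in> M \<Longrightarrow> cinner (x - p x) z = 0"
    using nearest_point[OF M] by metis
  have uniq: "p x = m" if "m \<in> M" "\<And>z. z \<in> M \<Longrightarrow> cinner (x - m) z = 0" for x m
  proof -
    have "cinner (p x - m) (p x - m) = cinner (x - m) (p x - m) - cinner (x - p x) (p x - m)"
      by (simp add: cinner_diff_left)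
    also have "\<dots> = 0"
      using that po pM Mdiff by simp
    finally show ?thesis by (simp add: cinner_self)
  qed
  have padd: "p (x + y) = p x + p y" for x y
  proof (rule uniq)
    fix z assume "z \<in> M"
    then show "cinner (x + y - (p x + p y)) z = 0"
      using po[of z x] po[of z y] by (simp add: cinner_diff_left cinner_add_left)
  qed (simp add: pM Madd)
  have pC: "p (c *\<^sub>C x) = c *\<^sub>C p x" for c x
  proof (rule uniq)
    fix z assume "z \<in> M"
    then show "cinner (c *\<^sub>C x - c *\<^sub>C p x) z = 0"
      using po[of z x] by (simp add: cinner_diff_left cinner_scaleC_left)
  qed (simp add: pM MC)
  have pin: "p x = x" if "x \<in> M" for x
    using that by (intro uniq) simp_all
  have sa: "cinner (p x) y = cinner x (p y)" for x y
  proof -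
    have "cinner (p x) (y - p y) = 0"
      using po[OF pM, of y x] cinner_commute by (metis complex_cnj_zero)
    moreover have "cinner (x - p x) (p y) = 0"
      using po[OF pM] .
    ultimately show ?thesis
      by (simp add: cinner_diff_left cinner_diff_right)
  qed
  have pn: "norm (p x) \<le> norm x * 1" for x
  proof -
    have "inner (x - p x) (p x) = 0"
      using po[OF pM, of x x] by (simp add: inner_eq_Re_cinner)
    then have "norm (p x) * norm (p x) = inner x (p x)"
      by (simp add: inner_diff_left flip: power2_norm_eq_inner power2_eq_square)
    also have "\<dots> \<le> norm x * norm (p x)"
      by (rule norm_cauchy_schwarz)
    finally show ?thesis
      by (cases "p x = 0") (simp_all add: mult_le_cancel_right)
  qed
  have "bounded_linear p"
    by (rule bounded_linear_intro[OF padd _ pn]) (simp add: scaleR_scaleC pC)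
  then have app: "blinfun_apply (Blinfun p) = p"
    by (rule bounded_linear_Blinfun_apply)
  have "Blinfun p o\<^sub>L Blinfun p = Blinfun p"
    by (rule blinfun_eqI) (simp add: app pin pM)
  then have "proj_op (Abs_proj (Blinfun p)) = Blinfun p"
    by (intro Abs_proj_inverse) (simp add: BH_def app pC sa)
  then have "prange (Abs_proj (Blinfun p)) = range p"
    by (simp add: prange_def app)
  also have "range p = M"
    using pM pin by (metis image_subset_iff rangeI subsetI subset_antisym)
  finally show ?thesis ..
qed

definition proj_onto :: "'a::complex_hilbert set \<Rightarrow> 'a proj" where
  "proj_onto M = (THE E. prange E = M)"

lemma prange_proj_onto: "closed_csubspace M \<Longrightarrow> prange (proj_onto M) = M"
  unfolding proj_onto_def using ex_proj_onto[of M] prange_eqD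
  by (metis (mono_tags, lifting) theI)

text \<open>
  Projections are ordered by inclusion of their ranges. This order determines all lattice
  operations: infima are the projections onto the intersections of the ranges, suprema are the least
  upper bounds.
\<close>

instantiation proj :: (complex_hilbert) complete_lattice
begin
definition less_eq_proj :: "'a proj \<Rightarrow> 'a proj \<Rightarrow> bool" where
  "E \<le> F \<longleftrightarrow> prange E \<subseteq> prange F"
definition less_proj :: "'a proj \<Rightarrow> 'a proj \<Rightarrow> bool" where
  "E < F \<longleftrightarrow> prange E \<subset> prange F"
definition Inf_proj :: "'a proj set \<Rightarrow> 'a proj" where
  "Inf S = proj_onto (\<Inter>E\<in>S. prange E)"
definition Sup_proj :: "'a proj set \<Rightarrow> 'a proj" where
  "Sup S = Inf {F :: 'a proj. \<forall>E\<in>S. E \<le> F}"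
definition inf_proj :: "'a proj \<Rightarrow> 'a proj \<Rightarrow> 'a proj" where
  "inf E F = Inf {E, F :: 'a proj}"
definition sup_proj :: "'a proj \<Rightarrow> 'a proj \<Rightarrow> 'a proj" where
  "sup E F = Sup {E, F :: 'a proj}"
definition bot_proj :: "'a proj" where
  "bot = (Abs_proj 0 :: 'a proj)"
definition top_proj :: "'a proj" where
  "top = (Abs_proj id_blinfun :: 'a proj)"

lemma prange_Inf: "prange (Inf S) = (\<Inter>E\<in>S. prange E)" for S :: "'a proj set"
  unfolding Inf_proj_def by (intro prange_proj_onto closed_csubspace_Inter closed_csubspace_prange)

lemma proj_op_bot: "proj_op (bot :: 'a proj) = 0"
  unfolding bot_proj_def
  by (rule Abs_proj_inverse)
    (auto simp: BH_def intro!: blinfun_eqI)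

lemma proj_op_top: "proj_op (top :: 'a proj) = id_blinfun"
  unfolding top_proj_def
  by (rule Abs_proj_inverse) (auto simp: BH_def intro!: blinfun_eqI)

instance
proof
  fix x y z :: "'a proj" and A :: "'a proj set"
  show "x \<le> y \<Longrightarrow> y \<le> x \<Longrightarrow> x = y"
    unfolding less_eq_proj_def by (intro prange_eqD subset_antisym)
  have le_Inf: "z \<le> Inf A \<longleftrightarrow> (\<forall>w\<in>A. z \<le> w)" for A :: "'a proj set" and z
    by (auto simp: less_eq_proj_def prange_Inf)
  have Inf_le: "w \<in> A \<Longrightarrow> Inf A \<le> w" for A :: "'a proj set" and w
    by (auto simp: less_eq_proj_def prange_Inf)
  show "x \<in> A \<Longrightarrow> Inf A \<le> x" by (rule Inf_le)
  show "(\<And>x. x \<in> A \<Longrightarrow> z \<le> x) \<Longrightarrow> z \<le> Inf A" by (simp add: le_Inf)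
  show "x \<in> A \<Longrightarrow> x \<le> Sup A" by (simp add: Sup_proj_def le_Inf)
  show "(\<And>x. x \<in> A \<Longrightarrow> x \<le> z) \<Longrightarrow> Sup A \<le> z"
    unfolding Sup_proj_def by (rule Inf_le) simp
  show "inf x y \<le> x" "inf x y \<le> y" by (simp_all add: inf_proj_def Inf_le)
  show "x \<le> y \<Longrightarrow> x \<le> z \<Longrightarrow> x \<le> inf y z" by (simp add: inf_proj_def le_Inf)
  show "x \<le> sup x y" "y \<le> sup x y" by (simp_all add: sup_proj_def Sup_proj_def le_Inf)
  show "y \<le> x \<Longrightarrow> z \<le> x \<Longrightarrow> sup y z \<le> x"
    unfolding sup_proj_def Sup_proj_def by (rule Inf_le) simp
  have "prange (top :: 'a proj) = UNIV"
    by (simp add: prange_def proj_op_top)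
  then show "Inf {} = (top :: 'a proj)"
    by (intro prange_eqD) (simp add: prange_Inf)
  have "prange (bot :: 'a proj) = {0}"
    by (simp add: prange_def proj_op_bot image_constant_conv)
  then have bot_le: "(bot :: 'a proj) \<le> w" for w
    using closed_csubspace_prange[of w] by (simp add: less_eq_proj_def closed_csubspace_def)
  have "Sup {} \<le> (bot :: 'a proj)"
    unfolding Sup_proj_def by (rule Inf_le) simp
  with bot_le[of "Sup {}"] show "Sup {} = (bot :: 'a proj)"
    unfolding less_eq_proj_def by (intro prange_eqD subset_antisym)
qed (auto simp: less_eq_proj_def less_proj_def)
end


section \<open>Subspace lattices\<close>

text \<open>\<open>maps_into T E F\<close> is the relation \<open>TE \<subseteq> F\<close>.\<close>

definition maps_into :: "('a::complex_hilbert \<Rightarrow>\<^sub>L 'a) \<Rightarrow> 'a proj \<Rightarrow> 'a proj \<Rightarrow> bool" where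
  "maps_into T E F \<longleftrightarrow> blinfun_apply T ` prange E \<subseteq> prange F"

text \<open>The infima and suprema are those of the lattice of all projections.\<close>

definition subspace_lattice :: "'a::complex_hilbert proj set \<Rightarrow> bool" where
  "subspace_lattice L \<longleftrightarrow> bot \<in> L \<and> top \<in> L \<and> (\<forall>S. S \<subseteq> L \<longrightarrow> Inf S \<in> L \<and> Sup S \<in> L)"

definition commutative_lattice :: "'a::complex_hilbert proj set \<Rightarrow> bool" where
  "commutative_lattice L \<longleftrightarrow> (\<forall>E\<in>L. \<forall>F\<in>L. proj_op E o\<^sub>L proj_op F = proj_op F o\<^sub>L proj_op E)"

text \<open>
  The complete distributive law, relativised to \<open>L\<close>, in the form of the library class
  \<^class>\<open>complete_distrib_lattice\<close>: the infimum over the \<open>Y \<in> \<A>\<close> of the suprema of the sets \<open>Y\<close> is the supremum,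
  over all choice functions \<open>f\<close>, of the infima of the selected elements \<open>f Y\<close>. The dual law
  is a consequence.
\<close>

definition completely_distributive :: "'a::complex_hilbert proj set \<Rightarrow> bool" where
  "completely_distributive L \<longleftrightarrow>
     (\<forall>\<A>. \<A> \<subseteq> Pow L \<longrightarrow>
        Inf (Sup ` \<A>) = Sup (Inf ` {f ` \<A> | f. \<forall>Y\<in>\<A>. f Y \<in> Y}))"

definition nest :: "'a::complex_hilbert proj set \<Rightarrow> bool" where
  "nest L \<longleftrightarrow> subspace_lattice L \<and> (\<forall>E\<in>L. \<forall>F\<in>L. E \<le> F \<or> F \<le> E)"

definition Alg :: "'a::complex_hilbert proj set \<Rightarrow> ('a \<Rightarrow>\<^sub>L 'a) set" where
  "Alg L = {T \<in> BH. \<forall>E\<in>L. maps_into T E E}"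

definition Lat :: "('a::complex_hilbert \<Rightarrow>\<^sub>L 'a) set \<Rightarrow> 'a proj set" where
  "Lat A = {E. \<forall>T\<in>A. maps_into T E E}"

definition op_subspace :: "('a::complex_hilbert \<Rightarrow>\<^sub>L 'a) set \<Rightarrow> bool" where
  "op_subspace U \<longleftrightarrow> U \<subseteq> BH \<and> 0 \<in> U \<and> (\<forall>S\<in>U. \<forall>T\<in>U. S + T \<in> U) \<and> (\<forall>c. \<forall>T\<in>U. op_scaleC c T \<in> U)"

definition right_submodule :: "('a::complex_hilbert \<Rightarrow>\<^sub>L 'a) set \<Rightarrow> ('a \<Rightarrow>\<^sub>L 'a) set \<Rightarrow> bool" where
  "right_submodule A U \<longleftrightarrow> op_subspace U \<and> (\<forall>T\<in>U. \<forall>S\<in>A. T o\<^sub>L S \<in> U)"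

definition left_submodule :: "('a::complex_hilbert \<Rightarrow>\<^sub>L 'a) set \<Rightarrow> ('a \<Rightarrow>\<^sub>L 'a) set \<Rightarrow> bool" where
  "left_submodule A U \<longleftrightarrow> op_subspace U \<and> (\<forall>S\<in>A. \<forall>T\<in>U. S o\<^sub>L T \<in> U)"

text \<open>
  \<open>Hom X\<close> is the set of order homomorphisms from \<open>X\<close> into the lattice of all projections; they are total functions
  whose values outside \<open>X\<close> are irrelevant.
\<close>

definition Hom :: "'a::complex_hilbert proj set \<Rightarrow> ('a proj \<Rightarrow> 'a proj) set" where
  "Hom X = {\<phi>. mono_on X \<phi>}"


section \<open>Nests are commutative and completely distributive\<close>

lemma proj_le_commute:
  assumes "E \<le> F"
  shows "proj_op E o\<^sub>L proj_op F = proj_op E" "proj_op F o\<^sub>L proj_op E = proj_op E"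
proof -
  let ?e = "blinfun_apply (proj_op E)" and ?f = "blinfun_apply (proj_op F)"
  have fe: "?f (?e x) = ?e x" for x
    using assms proj_op_mem_prange[of E x]
    by (simp add: less_eq_proj_def subset_iff flip: mem_prange_iff)
  have ef: "?e (?f x) = ?e x" for x
  proof -
    let ?w = "?e (?f x) - ?e x"
    have "cinner ?w z = 0" for z
      by (simp add: cinner_diff_left proj_op_selfadjoint fe)
    then have "cinner ?w ?w = 0" .
    then show ?thesis by (simp add: cinner_self)
  qed
  show "proj_op E o\<^sub>L proj_op F = proj_op E" "proj_op F o\<^sub>L proj_op E = proj_op E"
    by (rule blinfun_eqI, simp add: fe ef)+
qed

lemma nest_commutative: "nest L \<Longrightarrow> commutative_lattice L"
  unfolding nest_def commutative_lattice_def by (metis proj_le_commute)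

lemma nest_completely_distributive:
  fixes L :: "'a::complex_hilbert proj set"
  assumes "nest L"
  shows "completely_distributive L"
  unfolding completely_distributive_def
proof (intro allI impI antisym)
  fix \<A> :: "'a proj set set"
  assume AL: "\<A> \<subseteq> Pow L"
  have chain: "E \<le> F \<or> F \<le> E" if "E \<in> L" "F \<in> L" for E F
    using assms that by (auto simp: nest_def)
  have Sup_L: "Sup S \<in> L" and Inf_L: "Inf S \<in> L" if "S \<subseteq> L" for S
    using assms that by (auto simp: nest_def subspace_lattice_def)
  let ?I = "Inf (Sup ` \<A>)" and ?R = "Sup (Inf ` {f ` \<A> | f. \<forall>Y\<in>\<A>. f Y \<in> Y})"
  show "?R \<le> ?I"
    by (auto intro!: Sup_least Inf_greatest) (meson INF_lower2 Sup_upper)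
  have I_L: "?I \<in> L"
    using AL by (intro Inf_L) (auto intro!: Sup_L)
  have R_L: "?R \<in> L"
  proof (intro Sup_L subsetI)
    fix E assume "E \<in> Inf ` {f ` \<A> | f. \<forall>Y\<in>\<A>. f Y \<in> Y}"
    then obtain f where f: "\<forall>Y\<in>\<A>. f Y \<in> Y" and E: "E = Inf (f ` \<A>)" by blast
    have "f ` \<A> \<subseteq> L" using f AL by blast
    then show "E \<in> L" unfolding E by (rule Inf_L)
  qed
  have sel: "d \<le> ?R" if d: "\<And>Y. Y \<in> \<A> \<Longrightarrow> \<exists>y\<in>Y. d \<le> y" for d
  proof -
    obtain f where f: "\<And>Y. Y \<in> \<A> \<Longrightarrow> f Y \<in> Y \<and> d \<le> f Y"
      using d by metis
    have "d \<le> Inf (f ` \<A>)"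
      using f by (auto intro: INF_greatest)
    also have "\<dots> \<le> ?R"
      using f by (intro Sup_upper) blast
    finally show ?thesis .
  qed
  have above: "\<exists>y\<in>Y. \<not> y \<le> d" if "Y \<in> \<A>" "d < ?I" for Y d
  proof (rule ccontr)
    assume "\<not> ?thesis"
    then have "Sup Y \<le> d" by (auto intro: Sup_least)
    moreover have "?I \<le> Sup Y" using that by (intro Inf_lower) auto
    ultimately show False using that(2) by (meson leD order_trans)
  qed
  show "?I \<le> ?R"
  proof (rule ccontr)
    assume nle: "\<not> ?I \<le> ?R"
    then have less: "?R < ?I"
      using chain[OF I_L R_L] by (auto simp: less_le_not_le)
    show False
    proof (cases "\<exists>d\<in>L. ?R < d \<and> d < ?I")
      case True
      then obtain d where d: "d \<in> L" "?R < d" "d < ?I" by blast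
      have "\<exists>y\<in>Y. d \<le> y" if "Y \<in> \<A>" for Y
        using above[OF that d(3)] chain[OF d(1)] AL that by blast
      from sel[OF this] d(2) show False by (meson leD)
    next
      case False
      have "\<exists>y\<in>Y. ?I \<le> y" if Y: "Y \<in> \<A>" for Y
      proof -
        obtain y where y: "y \<in> Y" "\<not> y \<le> ?R"
          using above[OF Y less] by blast
        have yL: "y \<in> L" using y(1) Y AL by blast
        have "?R < y" using chain[OF yL R_L] y(2) by (auto simp: less_le_not_le)
        then have "\<not> y < ?I" using False yL by blast
        then have "?I \<le> y" using chain[OF yL I_L] by (auto simp: less_le_not_le)
        then show ?thesis using y(1) by blast
      qed
      from sel[OF this] nle show False by blast
    qed
  qed
qed

end

theory Submission
  imports Defs
begin

text \<open>
  The theorem rests on one density fact: for a commutative, completely distributive lattice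
  \<open>L\<close>, the identity is an ultraweak limit of linear combinations of rank-one operators in \<open>Alg L\<close>. Given this, let
  \<open>U\<close> be an ultraweakly closed right submodule and let \<open>T\<close> map each \<open>E\<close> into the closed span \<open>\<phi> E\<close> of \<open>U E\<close>.
  Then \<open>T\<close> is the limit of linear combinations of operators \<open>T R\<close> with \<open>R\<close> of rank one in \<open>Alg L\<close>, and each
  of these belongs to \<open>U\<close>: let \<open>R z = \<langle>z, b\<rangle> a\<close> with \<open>a\<close> in some \<open>F \<in> L\<close> such that \<open>z \<mapsto> \<langle>z, b\<rangle> a'\<close> belongs to
  \<open>Alg L\<close> for every \<open>a'\<close> in \<open>F\<close>; then \<open>T a\<close> is approximated by sums of vectors
  \<open>S a'\<close> with \<open>S \<in> U\<close> and \<open>a'\<close> in \<open>F\<close>, and \<open>z \<mapsto> \<langle>z, b\<rangle> S a'\<close> is the product of \<open>S\<close> and a rank-one operator of \<open>Alg L\<close>.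
  Left submodules are treated symmetrically.

  Everything is carried out in dual form, with the functionals \<open>S \<mapsto> \<Sum>n. \<langle>S x\<^sub>n, y\<^sub>n\<rangle>\<close> that vanish on
  \<open>U\<close>; \<open>sigma_weak_closed_memI\<close> says that these determine \<open>U\<close>, and \<open>right_submodule_annihilator\<close> and
  \<open>left_submodule_annihilator\<close> are the dual forms of the argument above. The density fact becomes
  \<open>pairing_eq_zero_if_annihilates_rank_ones\<close>: a functional that annihilates the rank-one operators
  \<open>z \<mapsto> \<langle>z, b\<rangle> a\<close>, where \<open>a\<close> is in some \<open>F \<in> L\<close> and \<open>b\<close> is orthogonal to \<open>F\<^sub>- = Sup {G \<in> L. \<not> F \<le> G}\<close>, vanishes at the
  identity.

  Its proof is measure theory without points. On a Hilbert space of functions, where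
  the elements of \<open>L\<close> are multiplications by indicator functions, the value at the identity is an integral over
  the diagonal, while the rank-one operators only see rectangles \<open>F \<times> F\<^sub>-\<^sup>c\<close>, which may miss the diagonal. Near
  a place where all the \<open>x\<^sub>n\<close> are nearly constant multiples of one vector \<open>h\<close>, however, the diagonal may be moved:
  averages of the \<open>x\<^sub>n\<close> over a small set \<open>p\<close> agree up to a small error with averages over any part of \<open>p\<close>.
  By complete distributivity (\<open>completely_distributive_separates\<close>) the set \<open>p\<close> has a nonnull part \<open>p F\<close> and a nonnull part
  \<open>p (1 - F\<^sub>-)\<close> for some \<open>F\<close>, and comparing the averages over the latter bounds the functional on the former
  (\<open>local_estimate\<close>). Exhaustion by such parts (\<open>annihilator_bound\<close>) shows that the total value is at most \<open>\<epsilon>\<close>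
  times a constant. Near constancy (\<open>locally_constant\<close>) is obtained from a Hahn decomposition. The
  measurable sets are replaced by the projections in the bicommutant of \<open>L\<close>, and the
  exhaustions use Zorn's lemma, which covers spaces of any dimension.
\<close>

section \<open>Inner products and projections\<close>

abbreviation proj_apply :: "'a::complex_hilbert proj \<Rightarrow> 'a \<Rightarrow> 'a" (infixr "\<cdot>" 76) where
  "E \<cdot> x \<equiv> blinfun_apply (proj_op E) x"

lemmas proj_linear_simps = blinfun.add_right blinfun.diff_right blinfun.zero_right
  proj_op_scaleC

lemma scaleC_diff_right: "c *\<^sub>C (x - y) = c *\<^sub>C x - c *\<^sub>C (y::'a::complex_hilbert)"
  using scaleC_add_right[of c "x - y" y] by (simp add: algebra_simps)

lemma scaleC_zero_left [simp]: "0 *\<^sub>C x = (0::'a::complex_hilbert)"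
  using scaleC_add_left[of 0 0 x] by simp

lemma cinner_eq_zero_commute: "cinner x y = 0 \<longleftrightarrow> cinner y (x::'a::complex_hilbert) = 0"
  by (metis cinner_commute complex_cnj_zero)

lemma cmod_cinner_le: "cmod (cinner x y) \<le> norm x * norm (y::'a::complex_hilbert)"
proof (cases "cinner x y = 0")
  case False
  \<comment> \<open>This unimodular factor turns \<open>\<langle>x, y\<rangle>\<close> into its modulus, a real number, to which the
      Cauchy-Schwarz inequality of the real inner product applies.\<close>
  define c where "c = cnj (cinner x y) / complex_of_real (cmod (cinner x y))"
  have "cmod c = 1"
    using False by (simp add: c_def norm_divide)
  have "c * cinner x y = complex_of_real (cmod (cinner x y))"
    using False complex_norm_square[of "cinner x y"]
    by (simp add: c_def field_simps power2_eq_square)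
  then have "cmod (cinner x y) = inner (c *\<^sub>C x) y"
    by (simp add: inner_eq_Re_cinner cinner_scaleC_left)
  also have "\<dots> \<le> norm (c *\<^sub>C x) * norm y"
    by (rule norm_cauchy_schwarz)
  finally show ?thesis
    by (simp add: norm_scaleC \<open>cmod c = 1\<close>)
qed simp

lemma tendsto_cinner:
  fixes a :: "'a::complex_hilbert"
  assumes "(f \<longlongrightarrow> a) F"
  shows "((\<lambda>t. cinner (f t) b) \<longlongrightarrow> cinner a b) F"
proof (rule Lim_null_comparison[THEN Lim_null[THEN iffD2]])
  show "((\<lambda>t. norm (f t - a) * norm b) \<longlongrightarrow> 0) F"
    by (rule tendsto_eq_intros tendsto_norm_zero assms[THEN Lim_null[THEN iffD1]] | simp)+
qed (simp add: cmod_cinner_le flip: cinner_diff_left)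

lemma closed_csubspace_orthogonal: "closed_csubspace {z. cinner z w = 0}"
  for w :: "'a::complex_hilbert"
proof -
  have "closed {z. cinner z w = 0}"
    by (rule closed_Collect_eq)
      (auto simp: continuous_on_def intro!: tendsto_cinner tendsto_ident_at)
  then show ?thesis
    by (simp add: closed_csubspace_def cinner_add_left cinner_scaleC_left)
qed

lemma eq_zeroI_cinner: "(\<And>z. cinner x z = 0) \<Longrightarrow> x = (0::'a::complex_hilbert)"
  using cinner_self[of x] by simp

lemma proj_op_eqI:
  assumes "y \<in> prange E" and "\<And>z. z \<in> prange E \<Longrightarrow> cinner (x - y) z = 0"
  shows "E \<cdot> x = y"
proof -
  have "cinner (E \<cdot> (x - y)) z = 0" for z
    using assms(2)[of "E \<cdot> z"] by (simp add: proj_op_selfadjoint)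
  then have "E \<cdot> (x - y) = 0"
    by (rule eq_zeroI_cinner)
  then show ?thesis
    using assms(1) by (simp add: mem_prange_iff proj_linear_simps)
qed

lemma le_proj_apply:
  assumes "E \<le> F"
  shows "F \<cdot> E \<cdot> x = E \<cdot> x" "E \<cdot> F \<cdot> x = E \<cdot> x"
  using arg_cong[OF proj_le_commute(2)[OF assms], of "\<lambda>T. blinfun_apply T x"]
    arg_cong[OF proj_le_commute(1)[OF assms], of "\<lambda>T. blinfun_apply T x"] by simp_all

lemma norm_proj_pythagoras: "(norm x)\<^sup>2 = (norm (E \<cdot> x))\<^sup>2 + (norm (x - E \<cdot> x))\<^sup>2"
proof -
  have "cinner (E \<cdot> x) (x - E \<cdot> x) = 0"
    by (simp add: proj_op_selfadjoint proj_linear_simps)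
  then have "inner (E \<cdot> x) (x - E \<cdot> x) = 0"
    by (simp add: inner_eq_Re_cinner)
  then show ?thesis
    unfolding power2_norm_eq_inner
    by (simp add: inner_diff_left inner_diff_right inner_commute)
qed

lemma norm_proj_le: "norm (E \<cdot> x) \<le> norm x"
  by (rule power2_le_imp_le) (use norm_proj_pythagoras[of x E] in simp_all)

lemma norm_proj_compl_le: "norm (x - E \<cdot> x) \<le> norm x"
  by (rule power2_le_imp_le) (use norm_proj_pythagoras[of x E] in simp_all)

lemma power2_norm_proj: "(norm (E \<cdot> x))\<^sup>2 = Re (cinner (E \<cdot> x) x)"
  using cinner_self[of "E \<cdot> x"] by (simp add: proj_op_selfadjoint)

lemma proj_bot_apply [simp]: "bot \<cdot> x = 0"
  by (simp add: proj_op_bot)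

definition compl_proj :: "'a::complex_hilbert proj \<Rightarrow> 'a proj" where
  "compl_proj E = Abs_proj (id_blinfun - proj_op E)"

lemma compl_proj_apply [simp]: "compl_proj E \<cdot> x = x - E \<cdot> x"
proof -
  have "proj_op (compl_proj E) = id_blinfun - proj_op E"
    unfolding compl_proj_def
    by (rule Abs_proj_inverse)
      (auto simp: BH_def blinfun.diff_left proj_linear_simps scaleC_diff_right cinner_diff_left
        cinner_diff_right proj_op_selfadjoint intro!: blinfun_eqI)
  then show ?thesis
    by (simp add: blinfun.diff_left)
qed

definition commuting :: "'a::complex_hilbert proj \<Rightarrow> 'a proj \<Rightarrow> bool" where
  "commuting E F \<longleftrightarrow> (\<forall>x. E \<cdot> F \<cdot> x = F \<cdot> E \<cdot> x)"

lemma commutingD: "commuting E F \<Longrightarrow> E \<cdot> F \<cdot> x = F \<cdot> E \<cdot> x"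
  unfolding commuting_def by blast

lemma commuting_sym: "commuting E F \<Longrightarrow> commuting F E"
  unfolding commuting_def by metis

text \<open>
  A projection is self-adjoint, so a subspace invariant under it is reducing.
\<close>

lemma commutingI_invariant:
  assumes "\<And>x. x \<in> prange E \<Longrightarrow> F \<cdot> x \<in> prange E"
  shows "commuting E F"
proof -
  have "E \<cdot> F \<cdot> x = F \<cdot> E \<cdot> x" for x
  proof (rule proj_op_eqI)
    show "F \<cdot> E \<cdot> x \<in> prange E"
      by (simp add: assms)
    fix z assume "z \<in> prange E"
    then have "E \<cdot> F \<cdot> z = F \<cdot> z"
      using assms by (metis mem_prange_iff)
    then show "cinner (F \<cdot> x - F \<cdot> E \<cdot> x) z = 0"
      by (simp add: cinner_diff_left proj_op_selfadjoint)
  qed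
  then show ?thesis
    by (simp add: commuting_def)
qed

lemma inf_proj_apply:
  assumes "commuting E F"
  shows "inf E F \<cdot> x = E \<cdot> F \<cdot> x"
proof (rule proj_op_eqI)
  have range: "prange (inf E F) = prange E \<inter> prange F"
    unfolding inf_proj_def prange_Inf by simp
  show "E \<cdot> F \<cdot> x \<in> prange (inf E F)"
    unfolding range using proj_op_mem_prange[of E "F \<cdot> x"] proj_op_mem_prange[of F "E \<cdot> x"]
    by (metis IntI commutingD[OF assms, of x])
  fix z assume "z \<in> prange (inf E F)"
  then have "E \<cdot> z = z" "F \<cdot> z = z"
    unfolding range by (simp_all add: mem_prange_iff)
  then show "cinner (x - E \<cdot> F \<cdot> x) z = 0"
    by (simp add: cinner_diff_left proj_op_selfadjoint)
qed

lemma le_orthogonal_iff: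
  "E \<le> proj_onto {z. cinner z w = 0} \<longleftrightarrow> E \<cdot> w = 0" for w :: "'a::complex_hilbert"
proof -
  have "E \<le> proj_onto {z. cinner z w = 0} \<longleftrightarrow> (\<forall>z. cinner z (E \<cdot> w) = 0)"
    unfolding less_eq_proj_def prange_proj_onto[OF closed_csubspace_orthogonal] prange_def[of E]
    by (force simp flip: proj_op_selfadjoint)
  also have "\<dots> \<longleftrightarrow> E \<cdot> w = 0"
    using eq_zeroI_cinner cinner_eq_zero_commute by (metis cinner_zero_right)
  finally show ?thesis .
qed

text \<open>
  For orthogonal projections the supremum is the sum. The sum maps into the range of the supremum;
  conversely, the error \<open>w\<close> is orthogonal to both ranges, so both projections lie below the one onto
  the orthogonal complement of \<open>w\<close>, and so does their supremum.
\<close>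

lemma sup_orthogonal_apply:
  assumes "\<And>x. E \<cdot> F \<cdot> x = 0"
  shows "sup E F \<cdot> x = E \<cdot> x + F \<cdot> x"
proof -
  have FE: "F \<cdot> E \<cdot> x = 0" for x
  proof (rule eq_zeroI_cinner)
    show "cinner (F \<cdot> E \<cdot> x) z = 0" for z
      by (simp add: proj_op_selfadjoint assms)
  qed
  have "E \<cdot> x \<in> prange (sup E F)" "F \<cdot> x \<in> prange (sup E F)"
    by (meson less_eq_proj_def proj_op_mem_prange subsetD sup.cobounded1 sup.cobounded2)+
  then have mem: "E \<cdot> x + F \<cdot> x \<in> prange (sup E F)"
    using closed_csubspace_prange[of "sup E F"] by (simp add: closed_csubspace_def)
  define w where "w = x - (E \<cdot> x + F \<cdot> x)"
  have "E \<le> proj_onto {z. cinner z w = 0}" "F \<le> proj_onto {z. cinner z w = 0}"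
    by (simp_all add: le_orthogonal_iff w_def proj_linear_simps assms FE)
  then have "sup E F \<le> proj_onto {z. cinner z w = 0}"
    by simp
  then have "cinner z w = 0" if "z \<in> prange (sup E F)" for z
    using that by (auto simp: less_eq_proj_def prange_proj_onto closed_csubspace_orthogonal)
  then show ?thesis
    by (intro proj_op_eqI mem) (simp add: w_def cinner_eq_zero_commute)
qed

lemma Sup_proj_orthogonal:
  assumes "\<And>E. E \<in> S \<Longrightarrow> E \<cdot> x = 0"
  shows "Sup S \<cdot> x = 0"
proof -
  let ?W = "proj_onto {z. cinner z x = 0}"
  have "Sup S \<le> ?W"
    using assms by (intro Sup_least) (simp add: le_orthogonal_iff)
  then show ?thesis
    by (simp add: le_orthogonal_iff)
qed

lemma closed_csubspace_closure:
  assumes "0 \<in> M" and "\<And>x y. x \<in> M \<Longrightarrow> y \<in> M \<Longrightarrow> x + y \<in> M"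
    and "\<And>c x. x \<in> M \<Longrightarrow> c *\<^sub>C x \<in> (M::'a::complex_hilbert set)"
  shows "closed_csubspace (closure M)"
proof -
  have "x + y \<in> closure M" if xy: "x \<in> closure M" "y \<in> closure M" for x y
  proof -
    obtain f g where "\<forall>n. f n \<in> M" "f \<longlonglongrightarrow> x" "\<forall>n. g n \<in> M" "g \<longlonglongrightarrow> y"
      using xy unfolding closure_sequential by blast
    then show ?thesis
      unfolding closure_sequential
      by (intro exI[of _ "\<lambda>n. f n + g n"]) (auto intro: assms tendsto_add)
  qed
  moreover have "c *\<^sub>C x \<in> closure M" if cx: "x \<in> closure M" for c x
  proof -
    obtain f where "\<forall>n. f n \<in> M" "f \<longlonglongrightarrow> x"
      using cx unfolding closure_sequential by blast
    then show ?thesis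
      unfolding closure_sequential
      by (intro exI[of _ "\<lambda>n. c *\<^sub>C f n"])
        (auto intro: assms bounded_linear.tendsto[OF bounded_linear_scaleC])
  qed
  moreover have "0 \<in> closure M"
    using assms(1) closure_subset by blast
  ultimately show ?thesis
    by (simp add: closed_csubspace_def)
qed

section \<open>Commutants\<close>

definition proj_commutant :: "'a::complex_hilbert proj set \<Rightarrow> 'a proj set" where
  "proj_commutant S = {E. \<forall>F\<in>S. commuting E F}"

lemma proj_commutantI:
  "(\<And>F x. F \<in> S \<Longrightarrow> E \<cdot> F \<cdot> x = F \<cdot> E \<cdot> x) \<Longrightarrow> E \<in> proj_commutant S"
  unfolding proj_commutant_def commuting_def by blast

lemma proj_commutantD: "E \<in> proj_commutant S \<Longrightarrow> F \<in> S \<Longrightarrow> E \<cdot> F \<cdot> x = F \<cdot> E \<cdot> x"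
  unfolding proj_commutant_def commuting_def by blast

lemma bot_in_proj_commutant: "bot \<in> proj_commutant S"
  by (rule proj_commutantI) (simp add: blinfun.zero_right)

lemma compl_proj_in_proj_commutant:
  assumes "E \<in> proj_commutant S"
  shows "compl_proj E \<in> proj_commutant S"
proof (rule proj_commutantI)
  show "compl_proj E \<cdot> G \<cdot> x = G \<cdot> compl_proj E \<cdot> x" if "G \<in> S" for G x
    using proj_commutantD[OF assms that, of x] by (simp add: blinfun.diff_right)
qed

lemma inf_in_proj_commutant:
  assumes "E \<in> proj_commutant S" "F \<in> proj_commutant S" "commuting E F"
  shows "inf E F \<in> proj_commutant S"
proof (rule proj_commutantI)
  show "inf E F \<cdot> G \<cdot> x = G \<cdot> inf E F \<cdot> x" if "G \<in> S" for G x
    using assms(1,2)[THEN proj_commutantD, OF that] by (simp add: inf_proj_apply[OF assms(3)])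
qed

lemma sup_in_proj_commutant:
  assumes "E \<in> proj_commutant S" "F \<in> proj_commutant S" "\<And>x. E \<cdot> F \<cdot> x = 0"
  shows "sup E F \<in> proj_commutant S"
proof (rule proj_commutantI)
  show "sup E F \<cdot> G \<cdot> x = G \<cdot> sup E F \<cdot> x" if "G \<in> S" for G x
    using assms(1,2)[THEN proj_commutantD, OF that]
    by (simp add: sup_orthogonal_apply[OF assms(3)] blinfun.add_right)
qed

section \<open>Chains of projections\<close>

text \<open>
  Both exhaustion arguments below apply Zorn's lemma to chains of projections. Chains may be
  uncountable, so limits are taken along the filter of final segments of the chain.
\<close>

definition proj_chain :: "'a::complex_hilbert proj set \<Rightarrow> bool" where
  "proj_chain C \<longleftrightarrow> C \<noteq> {} \<and> (\<forall>c\<in>C. \<forall>d\<in>C. c \<le> d \<or> d \<le> c)"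

definition chain_filter :: "'a::complex_hilbert proj set \<Rightarrow> 'a proj filter" where
  "chain_filter C = (INF c\<in>C. principal {d\<in>C. c \<le> d})"

lemma eventually_chain_filter:
  assumes "proj_chain C"
  shows "eventually P (chain_filter C) \<longleftrightarrow> (\<exists>c\<in>C. \<forall>d\<in>C. c \<le> d \<longrightarrow> P d)"
proof -
  have "\<exists>z\<in>C. principal {d\<in>C. z \<le> d} \<le> inf (principal {d\<in>C. x \<le> d}) (principal {d\<in>C. y \<le> d})"
    if xy: "x \<in> C" "y \<in> C" for x y
  proof -
    have "x \<le> y \<or> y \<le> x"
      using assms xy by (auto simp: proj_chain_def)
    then obtain z where "z \<in> C" "x \<le> z" "y \<le> z"
      using xy by blast
    then show ?thesis
      by (intro bexI[of _ z]) (auto intro: order_trans)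
  qed
  then show ?thesis
    unfolding chain_filter_def
    using assms by (subst eventually_INF_base) (auto simp: eventually_principal proj_chain_def)
qed

lemma chain_filter_neq_bot: "proj_chain C \<Longrightarrow> chain_filter C \<noteq> bot"
  unfolding trivial_limit_def by (auto simp: eventually_chain_filter)

lemma eventually_chain_filter_mem: "proj_chain C \<Longrightarrow> \<forall>\<^sub>F c in chain_filter C. c \<in> C"
  by (auto simp: eventually_chain_filter proj_chain_def)

lemma prange_Sup_chain:
  assumes C: "proj_chain C"
  shows "prange (Sup C) = closure (\<Union>c\<in>C. prange c)"
proof -
  let ?M = "\<Union>c\<in>C. prange c"
  have common: "\<exists>e\<in>C. x \<in> prange e \<and> y \<in> prange e" if "x \<in> ?M" "y \<in> ?M" for x y
    using that C unfolding proj_chain_def less_eq_proj_def by blast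
  have cl: "closed_csubspace (closure ?M)"
  proof (rule closed_csubspace_closure)
    show "0 \<in> ?M"
      using C closed_csubspace_prange by (force simp: proj_chain_def closed_csubspace_def)
    show "x + y \<in> ?M" if "x \<in> ?M" "y \<in> ?M" for x y
      using common[OF that] closed_csubspace_prange by (force simp: closed_csubspace_def)
    show "c *\<^sub>C x \<in> ?M" if "x \<in> ?M" for c x
      using that closed_csubspace_prange by (force simp: closed_csubspace_def)
  qed
  have "Sup C \<le> proj_onto (closure ?M)"
    using closure_subset[of ?M]
    by (intro Sup_least) (auto simp: less_eq_proj_def prange_proj_onto[OF cl])
  then have "prange (Sup C) \<subseteq> closure ?M"
    by (simp add: less_eq_proj_def prange_proj_onto[OF cl])
  moreover have "?M \<subseteq> prange (Sup C)"
    by (meson Sup_upper UN_least less_eq_proj_def)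
  then have "closure ?M \<subseteq> prange (Sup C)"
    using closed_csubspace_prange[of "Sup C"] by (intro closure_minimal) (auto simp: closed_csubspace_def)
  ultimately show ?thesis
    by blast
qed

text \<open>
  An increasing net of projections converges strongly to its supremum.
\<close>

lemma tendsto_Sup_chain:
  assumes C: "proj_chain C"
  shows "((\<lambda>c. c \<cdot> x) \<longlongrightarrow> Sup C \<cdot> x) (chain_filter C)"
proof (rule tendstoI)
  fix \<epsilon> :: real assume "\<epsilon> > 0"
  let ?z = "Sup C \<cdot> x"
  have "?z \<in> closure (\<Union>c\<in>C. prange c)"
    unfolding prange_Sup_chain[OF C, symmetric] by (rule proj_op_mem_prange)
  then obtain c w where c: "c \<in> C" "w \<in> prange c" "dist w ?z < \<epsilon>"
    using \<open>\<epsilon> > 0\<close> unfolding closure_approachable by blast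
  \<comment> \<open>Every later member of the chain fixes \<open>w\<close>, hence it moves the nearby vector \<open>Sup C \<cdot> x\<close> by at
      most the distance of the two.\<close>
  have "dist (d \<cdot> x) ?z < \<epsilon>" if "d \<in> C" "c \<le> d" for d
  proof -
    have "d \<le> Sup C"
      using that by (intro Sup_upper)
    moreover have "d \<cdot> w = w"
      using that(2) c(2) mem_prange_iff by (metis less_eq_proj_def subsetD)
    ultimately have "?z - d \<cdot> x = (?z - w) - d \<cdot> (?z - w)"
      by (simp add: blinfun.diff_right le_proj_apply)
    then have "norm (?z - d \<cdot> x) \<le> norm (?z - w)"
      by (metis norm_proj_compl_le)
    then show ?thesis
      using c(3) by (simp add: dist_norm norm_minus_commute)
  qed
  then show "\<forall>\<^sub>F c in chain_filter C. dist (c \<cdot> x) ?z < \<epsilon>"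
    using c(1) by (auto simp: eventually_chain_filter[OF C])
qed

lemma Sup_chain_in_proj_commutant:
  assumes C: "proj_chain C" and sub: "C \<subseteq> proj_commutant S"
  shows "Sup C \<in> proj_commutant S"
proof -
  have "Sup C \<cdot> F \<cdot> x = F \<cdot> Sup C \<cdot> x" if F: "F \<in> S" for F x
  proof (rule tendsto_unique[OF chain_filter_neq_bot[OF C]])
    show "((\<lambda>c. c \<cdot> F \<cdot> x) \<longlongrightarrow> Sup C \<cdot> F \<cdot> x) (chain_filter C)"
      by (rule tendsto_Sup_chain[OF C])
    have "((\<lambda>c. F \<cdot> c \<cdot> x) \<longlongrightarrow> F \<cdot> Sup C \<cdot> x) (chain_filter C)"
      by (intro bounded_linear.tendsto[OF blinfun.bounded_linear_right] tendsto_Sup_chain[OF C])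
    moreover have "\<forall>\<^sub>F c in chain_filter C. F \<cdot> c \<cdot> x = c \<cdot> F \<cdot> x"
      using eventually_chain_filter_mem[OF C]
      by eventually_elim (metis sub F proj_commutantD subsetD)
    ultimately show "((\<lambda>c. c \<cdot> F \<cdot> x) \<longlongrightarrow> F \<cdot> Sup C \<cdot> x) (chain_filter C)"
      by (rule Lim_transform_eventually)
  qed
  then show ?thesis
    by (rule proj_commutantI)
qed

text \<open>
  The exhaustion principle: an inequality between two functionals that are continuous along chains
  holds on a maximal projection of the commutant. In the applications both sides are additive
  on orthogonal projections, so the inequality fails on every nonzero projection of the commutant that is
  orthogonal to the maximal one.
\<close>

lemma maximal_proj_in_commutant:
  fixes \<alpha> \<beta> :: "'a::complex_hilbert proj \<Rightarrow> real"
  assumes \<alpha>: "\<And>C. proj_chain C \<Longrightarrow> (\<alpha> \<longlongrightarrow> \<alpha> (Sup C)) (chain_filter C)"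
    and \<beta>: "\<And>C. proj_chain C \<Longrightarrow> (\<beta> \<longlongrightarrow> \<beta> (Sup C)) (chain_filter C)"
    and bot: "\<alpha> bot \<le> \<beta> bot"
  obtains m where "m \<in> proj_commutant S" "\<alpha> m \<le> \<beta> m"
    "\<And>e. e \<in> proj_commutant S \<Longrightarrow> \<alpha> e \<le> \<beta> e \<Longrightarrow> m \<le> e \<Longrightarrow> e = m"
proof -
  define A where "A = {e \<in> proj_commutant S. \<alpha> e \<le> \<beta> e}"
  have "\<exists>m\<in>A. \<forall>a\<in>A. m \<le> a \<longrightarrow> a = m"
  proof (rule predicate_Zorn)
    show "partial_order_on A (relation_of (\<le>) A)"
      by (rule partial_order_on_relation_ofI) auto
    fix C assume "C \<in> Chains (relation_of (\<le>) A)"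
    then have sub: "C \<subseteq> A" and lin: "\<forall>c\<in>C. \<forall>d\<in>C. c \<le> d \<or> d \<le> c"
      by (auto simp: Chains_def relation_of_def)
    show "\<exists>u\<in>A. \<forall>a\<in>C. a \<le> u"
    proof (cases "C = {}")
      case True
      then show ?thesis
        using bot bot_in_proj_commutant by (auto simp: A_def)
    next
      case False
      then have C: "proj_chain C"
        using lin by (simp add: proj_chain_def)
      have "\<forall>\<^sub>F c in chain_filter C. \<alpha> c \<le> \<beta> c"
        using eventually_chain_filter_mem[OF C]
        by eventually_elim (use sub in \<open>auto simp: A_def\<close>)
      then have "\<alpha> (Sup C) \<le> \<beta> (Sup C)"
        using tendsto_le[OF chain_filter_neq_bot[OF C] \<beta>[OF C] \<alpha>[OF C]] by blast
      moreover have "Sup C \<in> proj_commutant S"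
        using sub by (intro Sup_chain_in_proj_commutant C) (auto simp: A_def)
      ultimately show ?thesis
        by (intro bexI[of _ "Sup C"]) (auto simp: A_def intro: Sup_upper)
    qed
  qed
  then show ?thesis
    using that by (auto simp: A_def)
qed

section \<open>Square-summable sequences of vectors\<close>

definition square_summable :: "(nat \<Rightarrow> 'a::complex_hilbert) \<Rightarrow> bool" where
  "square_summable x \<longleftrightarrow> summable (\<lambda>n. (norm (x n))\<^sup>2)"

definition sqnorm :: "(nat \<Rightarrow> 'a::complex_hilbert) \<Rightarrow> real" where
  "sqnorm x = (\<Sum>n. (norm (x n))\<^sup>2)"

definition pairing :: "(nat \<Rightarrow> 'a::complex_hilbert) \<Rightarrow> (nat \<Rightarrow> 'a) \<Rightarrow> complex" where
  "pairing x y = (\<Sum>n. cinner (x n) (y n))"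

lemma square_summable_mono:
  assumes "square_summable x" and "\<And>n. norm (y n) \<le> K * norm (x n)"
  shows "square_summable y"
  unfolding square_summable_def
proof (rule summable_comparison_test')
  show "summable (\<lambda>n. K\<^sup>2 * (norm (x n))\<^sup>2)"
    using assms(1) by (simp add: square_summable_def summable_mult)
  show "norm ((norm (y n))\<^sup>2) \<le> K\<^sup>2 * (norm (x n))\<^sup>2" for n
    using power_mono[OF assms(2)[of n] norm_ge_zero, of 2] by (simp add: power_mult_distrib)
qed

lemma square_summable_blinfun:
  "square_summable x \<Longrightarrow> square_summable (\<lambda>n. blinfun_apply T (x n))"
  by (erule square_summable_mono[where K = "norm T"]) (rule norm_blinfun)

lemma norm_add_power2_le: "(norm (a + b))\<^sup>2 \<le> 2 * (norm a)\<^sup>2 + 2 * (norm b)\<^sup>2"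
  for a b :: "'a::real_inner"
  using zero_le_power2[of "norm (a - b)"] unfolding power2_norm_eq_inner
  by (simp add: inner_diff_left inner_diff_right inner_add_left inner_add_right inner_commute)

lemma square_summable_add:
  assumes "square_summable x" "square_summable y"
  shows "square_summable (\<lambda>n. x n + y n)"
  unfolding square_summable_def
proof (rule summable_comparison_test')
  show "summable (\<lambda>n. 2 * (norm (x n))\<^sup>2 + 2 * (norm (y n))\<^sup>2)"
    using assms by (intro summable_add summable_mult) (simp_all add: square_summable_def)
qed (use norm_add_power2_le in simp)

lemma square_summable_diff:
  assumes "square_summable x" "square_summable y"
  shows "square_summable (\<lambda>n. x n - y n)"
proof -
  have "square_summable (\<lambda>n. - y n)"
    using assms(2) by (simp add: square_summable_def)
  from square_summable_add[OF assms(1) this] show ?thesis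
    by simp
qed

lemma square_summable_scaleC: "square_summable x \<Longrightarrow> square_summable (\<lambda>n. c *\<^sub>C x n)"
  by (erule square_summable_mono[where K = "cmod c"]) (simp add: norm_scaleC)

text \<open>
  The Cauchy-Schwarz inequality in additive form. It can be summed term by term, and an appropriate
  weight \<open>t\<close> recovers the product form.
\<close>

lemma cmod_cinner_weighted_le:
  fixes a b :: "'a::complex_hilbert"
  assumes "t > 0"
  shows "cmod (cinner a b) \<le> t / 2 * (norm a)\<^sup>2 + 1 / (2 * t) * (norm b)\<^sup>2"
proof -
  have "0 \<le> (t * norm a - norm b)\<^sup>2 / (2 * t)"
    using assms by simp
  then have "norm a * norm b \<le> t / 2 * (norm a)\<^sup>2 + 1 / (2 * t) * (norm b)\<^sup>2"
    using assms by (simp add: power2_eq_square field_simps)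
  then show ?thesis
    using cmod_cinner_le[of a b] by linarith
qed

lemma summable_weighted:
  assumes "square_summable x" "square_summable y"
  shows "summable (\<lambda>n. s * (norm (x n))\<^sup>2 + t * (norm (y n))\<^sup>2)"
  using assms by (intro summable_add summable_mult) (simp_all add: square_summable_def)

lemma summable_cmod_pairing:
  assumes "square_summable x" "square_summable y"
  shows "summable (\<lambda>n. cmod (cinner (x n) (y n)))"
proof (rule summable_comparison_test')
  show "summable (\<lambda>n. 1 / 2 * (norm (x n))\<^sup>2 + 1 / 2 * (norm (y n))\<^sup>2)"
    by (rule summable_weighted[OF assms])
qed (use cmod_cinner_weighted_le[of 1] in simp)

lemma summable_pairing:
  "square_summable x \<Longrightarrow> square_summable y \<Longrightarrow> summable (\<lambda>n. cinner (x n) (y n))"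
  by (rule summable_norm_cancel) (rule summable_cmod_pairing)

lemma cmod_pairing_weighted_le:
  assumes "square_summable x" "square_summable y" "t > 0"
  shows "cmod (pairing x y) \<le> t / 2 * sqnorm x + 1 / (2 * t) * sqnorm y"
proof -
  have "cmod (pairing x y) \<le> (\<Sum>n. cmod (cinner (x n) (y n)))"
    unfolding pairing_def by (rule summable_norm[OF summable_cmod_pairing[OF assms(1,2)]])
  also have "\<dots> \<le> (\<Sum>n. t / 2 * (norm (x n))\<^sup>2 + 1 / (2 * t) * (norm (y n))\<^sup>2)"
    by (intro suminf_le cmod_cinner_weighted_le summable_cmod_pairing summable_weighted assms)
  also have "\<dots> = t / 2 * sqnorm x + 1 / (2 * t) * sqnorm y"
    using assms(1,2) unfolding sqnorm_def square_summable_def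
    by (simp add: suminf_add[symmetric] suminf_mult summable_mult summable_divide suminf_divide)
  finally show ?thesis .
qed

lemma pairing_add_left:
  assumes "square_summable x" "square_summable x'" "square_summable y"
  shows "pairing (\<lambda>n. x n + x' n) y = pairing x y + pairing x' y"
  unfolding pairing_def cinner_add_left
  by (intro suminf_add[symmetric] summable_pairing assms)

lemma sqnorm_proj:
  assumes "square_summable x"
  shows "sqnorm (\<lambda>n. E \<cdot> x n) = Re (pairing (\<lambda>n. E \<cdot> x n) x)"
  unfolding sqnorm_def pairing_def power2_norm_proj
  by (intro Re_suminf[symmetric] summable_pairing square_summable_blinfun assms)

lemma sqnorm_nonneg: "square_summable x \<Longrightarrow> 0 \<le> sqnorm x"
  unfolding sqnorm_def square_summable_def by (intro suminf_nonneg) auto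

lemma power2_norm_le_sqnorm:
  assumes "square_summable x"
  shows "(norm (x n))\<^sup>2 \<le> sqnorm x"
  using assms sum_le_suminf[of "\<lambda>n. (norm (x n))\<^sup>2" "{n}"]
  unfolding sqnorm_def square_summable_def by simp

lemma sqnorm_le:
  assumes "square_summable x" and "\<And>n. norm (y n) \<le> K * norm (x n)"
  shows "sqnorm y \<le> K\<^sup>2 * sqnorm x"
proof -
  have sx: "summable (\<lambda>n. (norm (x n))\<^sup>2)"
    using assms(1) by (simp add: square_summable_def)
  have "sqnorm y \<le> (\<Sum>n. K\<^sup>2 * (norm (x n))\<^sup>2)"
    unfolding sqnorm_def
  proof (rule suminf_le)
    show "(norm (y n))\<^sup>2 \<le> K\<^sup>2 * (norm (x n))\<^sup>2" for n
      using power_mono[OF assms(2)[of n] norm_ge_zero, of 2] by (simp add: power_mult_distrib)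
    show "summable (\<lambda>n. (norm (y n))\<^sup>2)"
      using square_summable_mono[OF assms] by (simp add: square_summable_def)
  qed (rule summable_mult[OF sx])
  then show ?thesis
    by (simp add: sqnorm_def suminf_mult[OF sx])
qed

lemma pairing_scaleC_left:
  assumes "square_summable x" "square_summable y"
  shows "pairing (\<lambda>n. c *\<^sub>C x n) y = c * pairing x y"
  unfolding pairing_def cinner_scaleC_left
  by (rule suminf_mult[OF summable_pairing[OF assms]])

text \<open>
  The functionals \<open>E \<mapsto> \<Sum>n. \<langle>E x\<^sub>n, y\<^sub>n\<rangle>\<close> are normal: dominated convergence reduces this to the strong
  convergence of the chain at each \<open>x\<^sub>n\<close>.
\<close>

lemma tendsto_pairing_Sup_chain:
  assumes C: "proj_chain C" and x: "square_summable x" and y: "square_summable y"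
  shows "((\<lambda>c. pairing (\<lambda>n. c \<cdot> x n) y) \<longlongrightarrow> pairing (\<lambda>n. Sup C \<cdot> x n) y) (chain_filter C)"
  unfolding pairing_def
proof (rule tannerys_theorem[THEN conjunct2, THEN conjunct2])
  show "((\<lambda>c. cinner (c \<cdot> x n) (y n)) \<longlongrightarrow> cinner (Sup C \<cdot> x n) (y n)) (chain_filter C)" for n
    by (intro tendsto_cinner tendsto_Sup_chain C)
  show "summable (\<lambda>n. 1 / 2 * (norm (x n))\<^sup>2 + 1 / 2 * (norm (y n))\<^sup>2)"
    by (rule summable_weighted[OF x y])
  have "cmod (cinner (c \<cdot> x n) (y n)) \<le> 1 / 2 * (norm (x n))\<^sup>2 + 1 / 2 * (norm (y n))\<^sup>2" for c n
    using cmod_cinner_weighted_le[of 1 "c \<cdot> x n" "y n"] power_mono[OF norm_proj_le norm_ge_zero, of c "x n" 2]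
    by linarith
  then show "\<forall>\<^sub>F (n, c) in at_top \<times>\<^sub>F chain_filter C.
      cmod (cinner (c \<cdot> x n) (y n)) \<le> 1 / 2 * (norm (x n))\<^sup>2 + 1 / 2 * (norm (y n))\<^sup>2"
    by (intro always_eventually) auto
qed (rule chain_filter_neq_bot[OF C])

lemma tendsto_sqnorm_Sup_chain:
  assumes "proj_chain C" "square_summable x"
  shows "((\<lambda>c. sqnorm (\<lambda>n. c \<cdot> x n)) \<longlongrightarrow> sqnorm (\<lambda>n. Sup C \<cdot> x n)) (chain_filter C)"
  unfolding sqnorm_proj[OF assms(2)]
  by (intro tendsto_Re tendsto_pairing_Sup_chain assms)

lemma pairing_sup_orthogonal:
  assumes "\<And>z. E \<cdot> F \<cdot> z = 0" "square_summable x" "square_summable y"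
  shows "pairing (\<lambda>n. sup E F \<cdot> x n) y = pairing (\<lambda>n. E \<cdot> x n) y + pairing (\<lambda>n. F \<cdot> x n) y"
  unfolding sup_orthogonal_apply[OF assms(1)]
  by (intro pairing_add_left square_summable_blinfun assms)

text \<open>
  Since \<open>\<parallel>E x\<parallel>\<^sup>2 = \<langle>E x, x\<rangle>\<close>, squared norms are additive in the projection.
\<close>

lemma sqnorm_sup_orthogonal:
  assumes "\<And>z. E \<cdot> F \<cdot> z = 0" "square_summable x"
  shows "sqnorm (\<lambda>n. sup E F \<cdot> x n) = sqnorm (\<lambda>n. E \<cdot> x n) + sqnorm (\<lambda>n. F \<cdot> x n)"
  by (simp add: sqnorm_proj assms(2) pairing_sup_orthogonal[OF assms(1,2,2)])

lemma norm_sup_orthogonal: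
  assumes "\<And>z. E \<cdot> F \<cdot> z = 0"
  shows "(norm (sup E F \<cdot> h))\<^sup>2 = (norm (E \<cdot> h))\<^sup>2 + (norm (F \<cdot> h))\<^sup>2"
  unfolding power2_norm_proj by (simp add: sup_orthogonal_apply[OF assms] cinner_add_left)

lemma bounded_linear_cinner_left: "bounded_linear (\<lambda>x. cinner x (z::'a::complex_hilbert))"
  by (rule bounded_linear_intro[where K = "norm z"])
    (simp_all add: cinner_add_left scaleR_scaleC cinner_scaleC_left cmod_cinner_le
      scaleC_complex_def)

lemma summable_scaleC_square_summable:
  assumes c: "square_summable c" and x: "square_summable x"
  shows "summable (\<lambda>n. c n *\<^sub>C x n)"
proof (rule summable_norm_cancel, rule summable_comparison_test')
  show "summable (\<lambda>n. 1 / 2 * (norm (c n))\<^sup>2 + 1 / 2 * (norm (x n))\<^sup>2)"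
    by (rule summable_weighted[OF assms])
  show "norm (norm (c n *\<^sub>C x n)) \<le> 1 / 2 * (norm (c n))\<^sup>2 + 1 / 2 * (norm (x n))\<^sup>2" for n
    using zero_le_power2[of "norm (c n) - norm (x n)"]
    by (simp add: norm_scaleC power2_eq_square algebra_simps)
qed

lemma cinner_suminf_scaleC:
  assumes "square_summable c" "square_summable x"
  shows "cinner (\<Sum>n. c n *\<^sub>C x n) z = (\<Sum>n. c n * cinner (x n) z)"
  using bounded_linear.suminf[OF bounded_linear_cinner_left
      summable_scaleC_square_summable[OF assms], of z]
  by (simp add: cinner_scaleC_left)

lemma square_summable_cinner:
  assumes "square_summable x"
  shows "square_summable (\<lambda>n. cinner (x n) b)" "square_summable (\<lambda>n. cinner b (x n))"
  by (rule square_summable_mono[OF assms, where K = "norm b"],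
      metis cmod_cinner_le mult.commute)+

section \<open>Local domination and local proportionality\<close>

text \<open>
  This is one half of the Hahn decomposition theorem for the signed measure
  \<open>r \<mapsto> \<Sum>n. \<parallel>r u\<^sub>n\<parallel>\<^sup>2 - c \<parallel>r h\<parallel>\<^sup>2\<close> on the projections of a commutant: if its total mass is negative, then
  it is nonpositive below some projection that does not annihilate \<open>h\<close>. The complement of a maximal
  projection of nonnegative measure has this property.
\<close>

lemma local_domination:
  assumes u: "square_summable u" and less: "sqnorm u < c * (norm h)\<^sup>2"
  obtains p where "p \<in> proj_commutant S" "p \<cdot> h \<noteq> 0"
    "\<And>r. r \<in> proj_commutant S \<Longrightarrow> r \<le> p \<Longrightarrow> sqnorm (\<lambda>n. r \<cdot> u n) \<le> c * (norm (r \<cdot> h))\<^sup>2"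
proof -
  obtain m where m: "m \<in> proj_commutant S"
    and mle: "c * (norm (m \<cdot> h))\<^sup>2 \<le> sqnorm (\<lambda>n. m \<cdot> u n)"
    and max: "\<And>e. e \<in> proj_commutant S \<Longrightarrow> c * (norm (e \<cdot> h))\<^sup>2 \<le> sqnorm (\<lambda>n. e \<cdot> u n) \<Longrightarrow>
      m \<le> e \<Longrightarrow> e = m"
  proof (rule maximal_proj_in_commutant[of "\<lambda>e. c * (norm (e \<cdot> h))\<^sup>2"
        "\<lambda>e. sqnorm (\<lambda>n. e \<cdot> u n)" S])
    fix C :: "'a proj set" assume C: "proj_chain C"
    show "((\<lambda>e. c * (norm (e \<cdot> h))\<^sup>2) \<longlongrightarrow> c * (norm (Sup C \<cdot> h))\<^sup>2) (chain_filter C)"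
      by (intro tendsto_intros tendsto_Sup_chain C)
    show "((\<lambda>e. sqnorm (\<lambda>n. e \<cdot> u n)) \<longlongrightarrow> sqnorm (\<lambda>n. Sup C \<cdot> u n)) (chain_filter C)"
      by (rule tendsto_sqnorm_Sup_chain[OF C u])
  next
    show "c * (norm (bot \<cdot> h))\<^sup>2 \<le> sqnorm (\<lambda>n. bot \<cdot> u n)"
      by (simp add: sqnorm_def)
  qed blast
  show ?thesis
  proof
    show "compl_proj m \<in> proj_commutant S"
      by (rule compl_proj_in_proj_commutant[OF m])
    show "compl_proj m \<cdot> h \<noteq> 0"
    proof
      assume "compl_proj m \<cdot> h = 0"
      then have "c * (norm h)\<^sup>2 \<le> sqnorm (\<lambda>n. m \<cdot> u n)"
        using mle by simp
      also have "\<dots> \<le> sqnorm u"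
        using sqnorm_le[OF u, of "\<lambda>n. m \<cdot> u n" 1] by (simp add: norm_proj_le)
      finally show False
        using less by simp
    qed
  next
    fix r assume r: "r \<in> proj_commutant S" "r \<le> compl_proj m"
    show "sqnorm (\<lambda>n. r \<cdot> u n) \<le> c * (norm (r \<cdot> h))\<^sup>2"
    proof (rule ccontr)
      assume neg: "\<not> ?thesis"
      \<comment> \<open>Otherwise \<open>r\<close> could be added to the maximal projection \<open>m\<close>.\<close>
      have orth: "m \<cdot> r \<cdot> z = 0" for z
        using le_proj_apply(1)[OF r(2), of z] by simp
      have "sup m r = m"
      proof (rule max)
        show "sup m r \<in> proj_commutant S"
          by (rule sup_in_proj_commutant[OF m r(1) orth])
        show "c * (norm (sup m r \<cdot> h))\<^sup>2 \<le> sqnorm (\<lambda>n. sup m r \<cdot> u n)"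
          using mle neg by (simp add: norm_sup_orthogonal[OF orth] sqnorm_sup_orthogonal[OF orth u]
              distrib_left)
      qed simp
      then have "r \<cdot> z = 0" for z
        using sup_orthogonal_apply[OF orth, of z] by simp
      then show False
        using neg by (simp add: sqnorm_def)
    qed
  qed
qed

text \<open>
  In the application \<open>S\<close> is the commutant of the
  lattice, and \<open>B\<close> is the Boolean algebra of all projections of the von Neumann algebra generated by
  the lattice.
\<close>

locale abelian_commutant =
  fixes S :: "'a::complex_hilbert proj set"
  assumes abelian: "e \<in> proj_commutant S \<Longrightarrow> f \<in> proj_commutant S \<Longrightarrow> commuting e f"
begin

abbreviation "B \<equiv> proj_commutant S"

lemma inf_in_B: "e \<in> B \<Longrightarrow> f \<in> B \<Longrightarrow> inf e f \<in> B"
  by (intro inf_in_proj_commutant abelian)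

lemma inf_apply: "e \<in> B \<Longrightarrow> f \<in> B \<Longrightarrow> inf e f \<cdot> x = e \<cdot> f \<cdot> x"
  by (intro inf_proj_apply abelian)

lemma commute: "e \<in> B \<Longrightarrow> f \<in> B \<Longrightarrow> e \<cdot> f \<cdot> x = f \<cdot> e \<cdot> x"
  by (intro commutingD abelian)

text \<open>
  If \<open>B\<close> is viewed as an algebra of measurable sets and vectors as sections over the underlying space,
  then \<open>z\<close> is locally proportional to \<open>h\<close> when every set on which \<open>h\<close> does not vanish contains another
  such set on which \<open>z\<close> is a constant multiple of \<open>h\<close>. Finite linear combinations of the vectors \<open>e \<cdot> h\<close>
  with \<open>e \<in> B\<close>, the analogues of simple functions, have this property.
\<close>

definition locally_proportional :: "'a \<Rightarrow> 'a set" where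
  "locally_proportional h = {z. \<forall>p\<in>B. p \<cdot> h \<noteq> 0 \<longrightarrow>
     (\<exists>q\<in>B. q \<le> p \<and> q \<cdot> h \<noteq> 0 \<and> (\<exists>\<xi>. q \<cdot> z = \<xi> *\<^sub>C q \<cdot> h))}"

lemma locally_proportionalE:
  assumes "z \<in> locally_proportional h" "p \<in> B" "p \<cdot> h \<noteq> 0"
  obtains q \<xi> where "q \<in> B" "q \<le> p" "q \<cdot> h \<noteq> 0" "q \<cdot> z = \<xi> *\<^sub>C q \<cdot> h"
  using assms unfolding locally_proportional_def by blast

lemma proportional_mono:
  assumes "p \<cdot> z = \<xi> *\<^sub>C p \<cdot> h" "q \<le> p"
  shows "q \<cdot> z = \<xi> *\<^sub>C q \<cdot> h"
  using arg_cong[OF assms(1), of "\<lambda>v. q \<cdot> v"]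
  by (simp add: proj_op_scaleC le_proj_apply[OF assms(2)])

lemma locally_proportional_self: "h \<in> locally_proportional h"
  unfolding locally_proportional_def by (auto intro!: exI[of _ 1])

lemma locally_proportional_zero: "0 \<in> locally_proportional h"
  unfolding locally_proportional_def by (auto intro!: exI[of _ 0] simp: blinfun.zero_right)

lemma locally_proportional_scaleC:
  assumes "z \<in> locally_proportional h"
  shows "c *\<^sub>C z \<in> locally_proportional h"
  unfolding locally_proportional_def
proof (intro CollectI ballI impI)
  fix p assume "p \<in> B" "p \<cdot> h \<noteq> 0"
  then obtain q \<xi> where "q \<in> B" "q \<le> p" "q \<cdot> h \<noteq> 0" "q \<cdot> z = \<xi> *\<^sub>C q \<cdot> h"
    by (rule locally_proportionalE[OF assms])
  moreover from this have "q \<cdot> (c *\<^sub>C z) = (c * \<xi>) *\<^sub>C q \<cdot> h"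
    by (simp add: proj_op_scaleC scaleC_scaleC)
  ultimately show "\<exists>q\<in>B. q \<le> p \<and> q \<cdot> h \<noteq> 0 \<and> (\<exists>\<xi>. q \<cdot> (c *\<^sub>C z) = \<xi> *\<^sub>C q \<cdot> h)"
    by blast
qed

lemma locally_proportional_add:
  assumes "z \<in> locally_proportional h" "z' \<in> locally_proportional h"
  shows "z + z' \<in> locally_proportional h"
  unfolding locally_proportional_def
proof (intro CollectI ballI impI)
  fix p assume "p \<in> B" "p \<cdot> h \<noteq> 0"
  then obtain q \<xi> where q: "q \<in> B" "q \<le> p" "q \<cdot> h \<noteq> 0" "q \<cdot> z = \<xi> *\<^sub>C q \<cdot> h"
    by (rule locally_proportionalE[OF assms(1)])
  obtain q' \<xi>' where q': "q' \<in> B" "q' \<le> q" "q' \<cdot> h \<noteq> 0" "q' \<cdot> z' = \<xi>' *\<^sub>C q' \<cdot> h"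
    using q(1,3) by (rule locally_proportionalE[OF assms(2)])
  have "q' \<cdot> (z + z') = (\<xi> + \<xi>') *\<^sub>C q' \<cdot> h"
    using proportional_mono[OF q(4) q'(2)] q'(4) by (simp add: blinfun.add_right scaleC_add_left)
  then show "\<exists>q\<in>B. q \<le> p \<and> q \<cdot> h \<noteq> 0 \<and> (\<exists>\<xi>. q \<cdot> (z + z') = \<xi> *\<^sub>C q \<cdot> h)"
    using q q' order_trans by blast
qed

text \<open>
  Below \<open>q\<close>, where \<open>z\<close> is proportional to \<open>h\<close>, the vector \<open>e \<cdot> z\<close> is proportional to \<open>h\<close> inside \<open>e\<close> and
  vanishes outside, and \<open>h\<close> is nonzero on at least one of the two parts.
\<close>

lemma locally_proportional_proj:
  assumes z: "z \<in> locally_proportional h" and e: "e \<in> B"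
  shows "e \<cdot> z \<in> locally_proportional h"
  unfolding locally_proportional_def
proof (intro CollectI ballI impI)
  fix p assume "p \<in> B" "p \<cdot> h \<noteq> 0"
  then obtain q \<xi> where q: "q \<in> B" "q \<le> p" "q \<cdot> h \<noteq> 0" "q \<cdot> z = \<xi> *\<^sub>C q \<cdot> h"
    by (rule locally_proportionalE[OF z])
  show "\<exists>q\<in>B. q \<le> p \<and> q \<cdot> h \<noteq> 0 \<and> (\<exists>\<xi>. q \<cdot> e \<cdot> z = \<xi> *\<^sub>C q \<cdot> h)"
  proof (cases "q \<cdot> e \<cdot> h = 0")
    case False
    let ?r = "inf q e"
    have "?r \<cdot> e \<cdot> z = \<xi> *\<^sub>C ?r \<cdot> h"
      using proportional_mono[OF q(4), of ?r] by (simp add: inf_apply q(1) e)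
    moreover have "?r \<le> p"
      using q(2) by (meson inf.coboundedI1)
    ultimately show ?thesis
      using False by (intro bexI[of _ ?r]) (auto simp: inf_apply inf_in_B q(1) e)
  next
    case True
    let ?r = "inf q (compl_proj e)"
    have e': "compl_proj e \<in> B"
      by (rule compl_proj_in_proj_commutant[OF e])
    have "?r \<cdot> e \<cdot> z = 0 *\<^sub>C ?r \<cdot> h"
      by (simp add: inf_apply q(1) e' blinfun.zero_right)
    moreover have "?r \<cdot> h \<noteq> 0"
      using True q(3) by (simp add: inf_apply q(1) e' blinfun.diff_right)
    moreover have "?r \<le> p"
      using q(2) by (meson inf.coboundedI1)
    ultimately show ?thesis
      using inf_in_B[OF q(1) e'] by blast
  qed
qed

lemma simultaneously_proportional:
  assumes "\<And>n. n < (N::nat) \<Longrightarrow> s n \<in> locally_proportional h" "p \<in> B" "p \<cdot> h \<noteq> 0"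
  obtains q where "q \<in> B" "q \<le> p" "q \<cdot> h \<noteq> 0" "\<forall>n<N. \<exists>\<xi>. q \<cdot> s n = \<xi> *\<^sub>C q \<cdot> h"
proof -
  have "\<exists>q\<in>B. q \<le> p \<and> q \<cdot> h \<noteq> 0 \<and> (\<forall>n<N. \<exists>\<xi>. q \<cdot> s n = \<xi> *\<^sub>C q \<cdot> h)"
    using assms(1)
  proof (induction N)
    case 0
    then show ?case
      using assms(2,3) by blast
  next
    case (Suc N)
    then obtain q where q: "q \<in> B" "q \<le> p" "q \<cdot> h \<noteq> 0" "\<forall>n<N. \<exists>\<xi>. q \<cdot> s n = \<xi> *\<^sub>C q \<cdot> h"
      by auto
    have "s N \<in> locally_proportional h"
      using Suc.prems by simp
    then obtain q' \<xi>' where q': "q' \<in> B" "q' \<le> q" "q' \<cdot> h \<noteq> 0" "q' \<cdot> s N = \<xi>' *\<^sub>C q' \<cdot> h"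
      using q(1,3) by (rule locally_proportionalE)
    have "\<forall>n<Suc N. \<exists>\<xi>. q' \<cdot> s n = \<xi> *\<^sub>C q' \<cdot> h"
      using q(4) q'(4) proportional_mono[OF _ q'(2)] by (metis less_Suc_eq)
    then show ?case
      using q q' order_trans by blast
  qed
  then show ?thesis
    using that by blast
qed

text \<open>
  A measurable function with values in \<open>\<ell>\<^sup>2\<close> is nearly constant on a set of positive measure. Here the
  function is the family of quotients of the \<open>x\<^sub>n\<close> by \<open>h\<close>, and being nearly equal to \<open>\<xi>\<close> on \<open>p\<close> is
  expressed by an estimate for every part \<open>r\<close> of \<open>p\<close>. The sequence is approximated in square mean by
  finitely many locally proportional vectors; local domination turns this into an estimate that
  holds for all parts of one projection, on a part of which all approximants are multiples of \<open>h\<close>.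
\<close>

lemma locally_constant:
  assumes x: "square_summable x" and cl: "\<And>n. x n \<in> closure (locally_proportional h)"
    and h: "h \<noteq> 0" and \<epsilon>: "\<epsilon> > 0"
  obtains p \<xi> where "p \<in> B" "p \<cdot> h \<noteq> 0" "square_summable (\<xi> :: nat \<Rightarrow> complex)"
    "\<And>r. r \<in> B \<Longrightarrow> r \<le> p \<Longrightarrow> sqnorm (\<lambda>n. r \<cdot> x n - \<xi> n *\<^sub>C r \<cdot> h) \<le> \<epsilon> * (norm (r \<cdot> h))\<^sup>2"
proof -
  define \<delta> where "\<delta> = \<epsilon> * (norm h)\<^sup>2"
  have \<delta>: "\<delta> > 0"
    using h \<epsilon> by (simp add: \<delta>_def)
  have "summable (\<lambda>n. (norm (x n))\<^sup>2)"
    using x by (simp add: square_summable_def)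
  then obtain N where N: "(\<Sum>n. (norm (x (n + N)))\<^sup>2) < \<delta> / 2"
    using suminf_exist_split[of "\<delta> / 2" "\<lambda>n. (norm (x n))\<^sup>2"] \<delta>
    by (metis abs_less_iff half_gt_zero order_refl real_norm_def)
  have "\<exists>z\<in>locally_proportional h. (norm (x n - z))\<^sup>2 < \<delta> / (2 * (real N + 1))" for n
  proof -
    have "sqrt (\<delta> / (2 * (real N + 1))) > 0"
      using \<delta> by simp
    then obtain z where z: "z \<in> locally_proportional h" "dist z (x n) < sqrt (\<delta> / (2 * (real N + 1)))"
      using cl[of n] unfolding closure_approachable by blast
    have "(norm (x n - z))\<^sup>2 < (sqrt (\<delta> / (2 * (real N + 1))))\<^sup>2"
      using z(2) by (intro power_strict_mono) (simp_all add: dist_norm norm_minus_commute)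
    then show ?thesis
      using z(1) \<delta> by (intro bexI[of _ z]) simp_all
  qed
  then obtain s' where s': "\<And>n. s' n \<in> locally_proportional h"
    "\<And>n. (norm (x n - s' n))\<^sup>2 < \<delta> / (2 * (real N + 1))"
    by metis
  define s where "s n = (if n < N then s' n else 0)" for n
  have s_summable: "square_summable s"
    unfolding square_summable_def by (rule summable_finite[of "{..<N}"]) (auto simp: s_def)
  define u where "u n = x n - s n" for n
  have u: "square_summable u"
    unfolding u_def by (rule square_summable_diff[OF x s_summable])
  have "sqnorm u = (\<Sum>n. (norm (u (n + N)))\<^sup>2) + (\<Sum>n<N. (norm (u n))\<^sup>2)"
    unfolding sqnorm_def using u by (intro suminf_split_initial_segment) (simp add: square_summable_def)
  also have "(\<Sum>n. (norm (u (n + N)))\<^sup>2) < \<delta> / 2"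
    using N by (simp add: u_def s_def)
  also have "(\<Sum>n<N. (norm (u n))\<^sup>2) \<le> (\<Sum>n<N. \<delta> / (2 * (real N + 1)))"
    using s'(2) by (intro sum_mono) (simp add: u_def s_def less_imp_le)
  also have "\<dots> \<le> \<delta> / 2"
    using \<delta> by (simp add: field_simps)
  finally have "sqnorm u < \<epsilon> * (norm h)\<^sup>2"
    by (simp add: \<delta>_def)
  then obtain p where p: "p \<in> B" "p \<cdot> h \<noteq> 0"
    and dom: "\<And>r. r \<in> B \<Longrightarrow> r \<le> p \<Longrightarrow> sqnorm (\<lambda>n. r \<cdot> u n) \<le> \<epsilon> * (norm (r \<cdot> h))\<^sup>2"
    by (rule local_domination[OF u, where S = S]) blast
  have "s n \<in> locally_proportional h" if "n < N" for n
    using s' that by (simp add: s_def)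
  then obtain q where q: "q \<in> B" "q \<le> p" "q \<cdot> h \<noteq> 0" "\<forall>n<N. \<exists>\<xi>. q \<cdot> s n = \<xi> *\<^sub>C q \<cdot> h"
    using p by (rule simultaneously_proportional)
  then obtain \<xi>' where \<xi>': "\<forall>n<N. q \<cdot> s n = \<xi>' n *\<^sub>C q \<cdot> h"
    by metis
  define \<xi> where "\<xi> n = (if n < N then \<xi>' n else 0)" for n
  have \<xi>: "q \<cdot> s n = \<xi> n *\<^sub>C q \<cdot> h" for n
    using \<xi>' by (simp add: \<xi>_def s_def blinfun.zero_right)
  show ?thesis
  proof
    show "square_summable \<xi>"
      unfolding square_summable_def by (rule summable_finite[of "{..<N}"]) (auto simp: \<xi>_def)
  next
    fix r assume r: "r \<in> B" "r \<le> q"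
    have "r \<cdot> x n - \<xi> n *\<^sub>C r \<cdot> h = r \<cdot> u n" for n
      by (simp add: u_def blinfun.diff_right proportional_mono[OF \<xi> r(2)])
    then show "sqnorm (\<lambda>n. r \<cdot> x n - \<xi> n *\<^sub>C r \<cdot> h) \<le> \<epsilon> * (norm (r \<cdot> h))\<^sup>2"
      using dom[OF r(1) order_trans[OF r(2) q(2)]] by simp
  qed (use q in auto)
qed

end

section \<open>Completely distributive lattices\<close>

text \<open>
  The element usually written \<open>F\<^sub>-\<close>. The operator \<open>z \<mapsto> \<langle>z, b\<rangle> a\<close> belongs to \<open>Alg L\<close> as soon as
  \<open>a\<close> lies in some \<open>F \<in> L\<close> and \<open>b\<close> is orthogonal to \<open>F\<^sub>-\<close>.
\<close>

definition minus_proj :: "'a::complex_hilbert proj set \<Rightarrow> 'a proj \<Rightarrow> 'a proj" where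
  "minus_proj L F = Sup {G \<in> L. \<not> F \<le> G}"

lemma minus_proj_mem: "subspace_lattice L \<Longrightarrow> minus_proj L F \<in> L"
  unfolding subspace_lattice_def minus_proj_def by auto

text \<open>
  The complete distributive law is applied to the family of all subsets of \<open>L\<close> whose supremum
  dominates \<open>E\<close>. If \<open>F\<close> is the infimum of a selection from this family, then \<open>E \<le> F\<^sub>-\<close> is impossible:
  the set defining \<open>F\<^sub>-\<close> would belong to the family, but none of its elements lies above \<open>F\<close>.
\<close>

lemma completely_distributive_le_Sup:
  assumes L: "subspace_lattice L" and cd: "completely_distributive L" and E: "E \<in> L"
  shows "E \<le> Sup {F \<in> L. \<not> E \<le> minus_proj L F}"
proof -
  define \<A> where "\<A> = {Y. Y \<subseteq> L \<and> E \<le> Sup Y}"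
  have "E \<le> Inf (Sup ` \<A>)"
    by (rule INF_greatest) (simp add: \<A>_def)
  also have "\<dots> = Sup (Inf ` {f ` \<A> | f. \<forall>Y\<in>\<A>. f Y \<in> Y})"
    by (rule cd[unfolded completely_distributive_def, rule_format]) (auto simp: \<A>_def)
  also have "\<dots> \<le> Sup {F \<in> L. \<not> E \<le> minus_proj L F}"
  proof (rule Sup_least)
    fix F assume "F \<in> Inf ` {f ` \<A> | f. \<forall>Y\<in>\<A>. f Y \<in> Y}"
    then obtain f where f: "\<forall>Y\<in>\<A>. f Y \<in> Y" and F: "F = Inf (f ` \<A>)"
      by blast
    have "f ` \<A> \<subseteq> L"
      using f by (auto simp: \<A>_def)
    then have FL: "F \<in> L"
      using L unfolding F subspace_lattice_def by blast
    have "\<not> E \<le> minus_proj L F"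
    proof
      let ?Y = "{G \<in> L. \<not> F \<le> G}"
      assume "E \<le> minus_proj L F"
      then have Y: "?Y \<in> \<A>"
        unfolding \<A>_def minus_proj_def by blast
      then have "F \<le> f ?Y"
        unfolding F by (intro Inf_lower imageI)
      moreover have "f ?Y \<in> ?Y"
        by (rule bspec[OF f Y])
      ultimately show False
        by simp
    qed
    then show "F \<le> Sup {F \<in> L. \<not> E \<le> minus_proj L F}"
      using FL by (intro Sup_upper) simp
  qed
  finally show ?thesis .
qed

text \<open>
  The form in which complete distributivity is used: every nonzero vector \<open>k\<close> meets both sides of
  one of the pairs \<open>F\<close>, \<open>1 - F\<^sub>-\<close> that generate rank-one operators of the algebra. With \<open>E\<close> the least element
  of \<open>L\<close> containing \<open>k\<close>, the condition \<open>F\<^sub>- \<cdot> k \<noteq> k\<close> says \<open>\<not> E \<le> F\<^sub>-\<close>, and the elements \<open>F\<close> with this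
  property have a supremum above \<open>E\<close>, so they cannot all be orthogonal to \<open>k\<close>.
\<close>

lemma completely_distributive_separates:
  assumes L: "subspace_lattice L" and cd: "completely_distributive L" and k: "k \<noteq> 0"
  shows "\<exists>F\<in>L. F \<cdot> k \<noteq> 0 \<and> minus_proj L F \<cdot> k \<noteq> k"
proof (rule ccontr)
  assume neg: "\<not> ?thesis"
  define E where "E = Inf {G \<in> L. G \<cdot> k = k}"
  have EL: "E \<in> L"
    using L unfolding E_def subspace_lattice_def by auto
  have kE: "k \<in> prange E"
    unfolding E_def prange_Inf by (simp add: mem_prange_iff)
  let ?R = "Sup {F \<in> L. \<not> E \<le> minus_proj L F}"
  have "?R \<cdot> k = 0"
  proof (rule Sup_proj_orthogonal)
    fix F assume "F \<in> {F \<in> L. \<not> E \<le> minus_proj L F}"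
    then have F: "F \<in> L" "\<not> E \<le> minus_proj L F"
      by simp_all
    have "minus_proj L F \<cdot> k \<noteq> k"
    proof
      assume "minus_proj L F \<cdot> k = k"
      then have "E \<le> minus_proj L F"
        unfolding E_def using minus_proj_mem[OF L] by (intro Inf_lower) simp
      then show False
        using F(2) by simp
    qed
    then show "F \<cdot> k = 0"
      using neg F(1) by blast
  qed
  moreover have "k \<in> prange ?R"
    using completely_distributive_le_Sup[OF L cd EL] kE unfolding less_eq_proj_def by blast
  ultimately show False
    using k by (simp add: mem_prange_iff)
qed

section \<open>Functionals annihilating the rank-one operators of the algebra\<close>

text \<open>
  On a projection \<open>p\<close> where \<open>x\<^sub>n \<approx> \<xi>\<^sub>n h\<close>, separation of \<open>p \<cdot> h\<close> provides two parts \<open>r = p F\<close> and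
  \<open>q = p (1 - F\<^sub>-)\<close> that both see \<open>h\<close>. On \<open>r\<close> the functional is approximately \<open>\<Sum>n. \<xi>\<^sub>n \<langle>r h, y\<^sub>n\<rangle>\<close>.
  Approximating \<open>\<langle>x\<^sub>n, q h\<rangle>\<close> by \<open>\<xi>\<^sub>n \<parallel>q h\<parallel>\<^sup>2\<close> shows that this sum is, up to the factor \<open>\<parallel>q h\<parallel>\<^sup>2\<close>, approximately
  the value of the functional at the rank-one operator built from \<open>r h\<close> and \<open>q h\<close>, which is
  zero. Both errors are controlled by the same local estimate.
\<close>

lemma (in abelian_commutant) local_estimate:
  assumes sep: "\<And>k. k \<noteq> 0 \<Longrightarrow> \<exists>F\<in>L. F \<cdot> k \<noteq> 0 \<and> m F \<cdot> k \<noteq> k"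
    and LB: "L \<subseteq> B" and mB: "\<And>F. F \<in> L \<Longrightarrow> m F \<in> B"
    and annih: "\<And>F a b. F \<in> L \<Longrightarrow> F \<cdot> a = a \<Longrightarrow> m F \<cdot> b = 0 \<Longrightarrow>
      (\<Sum>n. cinner (x n) b * cinner a (y n)) = 0"
    and x: "square_summable x" and y: "square_summable y"
    and cl: "\<And>n. x n \<in> closure (locally_proportional h)"
    and h: "h \<noteq> 0" and \<epsilon>: "\<epsilon> > 0"
  shows "\<exists>r\<in>B. r \<cdot> h \<noteq> 0 \<and>
    cmod (pairing (\<lambda>n. r \<cdot> x n) y) \<le> \<epsilon> * ((norm (r \<cdot> h))\<^sup>2 + sqnorm (\<lambda>n. r \<cdot> y n))"
proof -
  have "\<epsilon>\<^sup>2 > 0"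
    using \<epsilon> by simp
  then obtain p \<xi> where p: "p \<in> B" "p \<cdot> h \<noteq> 0" and \<xi>: "square_summable (\<xi> :: nat \<Rightarrow> complex)"
    and const: "\<And>r. r \<in> B \<Longrightarrow> r \<le> p \<Longrightarrow>
      sqnorm (\<lambda>n. r \<cdot> x n - \<xi> n *\<^sub>C r \<cdot> h) \<le> \<epsilon>\<^sup>2 * (norm (r \<cdot> h))\<^sup>2"
    by (rule locally_constant[OF x cl h]) blast
  obtain F where F: "F \<in> L" "F \<cdot> p \<cdot> h \<noteq> 0" "m F \<cdot> p \<cdot> h \<noteq> p \<cdot> h"
    using sep[OF p(2)] by blast
  have FB: "F \<in> B" and mFB: "m F \<in> B"
    using F(1) LB mB by auto
  have cB: "compl_proj (m F) \<in> B"
    by (rule compl_proj_in_proj_commutant[OF mFB])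
  define r q where "r = inf p F" and "q = inf p (compl_proj (m F))"
  have r: "r \<in> B" "r \<le> p" and q: "q \<in> B" "q \<le> p"
    using p(1) FB cB by (simp_all add: r_def q_def inf_in_B)
  have r_apply: "r \<cdot> z = F \<cdot> p \<cdot> z" for z
    unfolding r_def by (simp add: inf_apply p(1) FB commute)
  have q_apply: "q \<cdot> z = p \<cdot> z - m F \<cdot> p \<cdot> z" for z
    unfolding q_def by (simp add: inf_apply p(1) cB blinfun.diff_right commute[OF p(1) mFB])
  define a b where "a = r \<cdot> h" and "b = q \<cdot> h"
  have a: "a \<noteq> 0" "F \<cdot> a = a" "r \<cdot> a = a"
    using F(2) by (simp_all add: a_def) (simp add: r_apply)+
  have b: "b \<noteq> 0" "m F \<cdot> b = 0" "q \<cdot> b = b"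
    using F(3) by (simp_all add: b_def) (simp add: q_apply blinfun.diff_right)+
  define \<beta> where "\<beta> = (norm b)\<^sup>2"
  have \<beta>: "\<beta> > 0"
    using b(1) by (simp add: \<beta>_def)
  \<comment> \<open>The deviations from proportionality on the two parts.\<close>
  define d g where "d n = r \<cdot> x n - \<xi> n *\<^sub>C a" and "g n = q \<cdot> x n - \<xi> n *\<^sub>C b" for n
  have scaled: "square_summable (\<lambda>n. \<xi> n *\<^sub>C v)" for v :: 'a
    by (rule square_summable_mono[OF \<xi>, where K = "norm v"]) (simp add: norm_scaleC mult.commute)
  have d: "square_summable d" and g: "square_summable g"
    unfolding d_def g_def by (intro square_summable_diff square_summable_blinfun x scaled)+
  have d_le: "sqnorm d \<le> \<epsilon>\<^sup>2 * (norm a)\<^sup>2" and g_le: "sqnorm g \<le> \<epsilon>\<^sup>2 * \<beta>"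
    using const[OF r] const[OF q] by (simp_all add: d_def[abs_def] g_def[abs_def] a_def b_def \<beta>_def)
  define ry where "ry n = r \<cdot> y n" for n
  have ry: "square_summable ry"
    unfolding ry_def by (rule square_summable_blinfun[OF y])
  define v where "v n = cinner (y n) a" for n
  have v: "square_summable v"
    unfolding v_def by (rule square_summable_cinner[OF y])
  have v_le: "sqnorm v \<le> (norm a)\<^sup>2 * sqnorm ry"
  proof (rule sqnorm_le[OF ry])
    have "v n = cinner (ry n) a" for n
      by (simp add: v_def ry_def proj_op_selfadjoint a(3))
    then show "cmod (v n) \<le> norm a * norm (ry n)" for n
      using cmod_cinner_le[of "ry n" a] by (simp add: mult.commute)
  qed
  \<comment> \<open>The functional on \<open>r\<close> splits into the contribution of the deviation and \<open>\<Sum>n. \<xi>\<^sub>n \<langle>a, y\<^sub>n\<rangle>\<close>.\<close>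
  have "pairing (\<lambda>n. r \<cdot> x n) y = pairing (\<lambda>n. d n + \<xi> n *\<^sub>C a) y"
    by (simp add: d_def)
  also have "\<dots> = pairing d y + pairing (\<lambda>n. \<xi> n *\<^sub>C a) y"
    by (rule pairing_add_left[OF d scaled y])
  also have "pairing d y = pairing d ry"
  proof -
    have "r \<cdot> d n = d n" for n
      by (simp add: d_def blinfun.diff_right proj_op_scaleC a(3))
    then have "cinner (d n) (y n) = cinner (d n) (ry n)" for n
      using proj_op_selfadjoint[of r "d n" "y n"] by (simp add: ry_def)
    then show ?thesis
      by (simp add: pairing_def)
  qed
  also have "pairing (\<lambda>n. \<xi> n *\<^sub>C a) y = pairing \<xi> v"
    unfolding pairing_def v_def
    by (simp add: cinner_scaleC_left cinner_complex_def flip: cinner_commute[of a])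
  finally have split: "pairing (\<lambda>n. r \<cdot> x n) y = pairing d ry + pairing \<xi> v" .
  have "cmod (pairing d ry) \<le> (1 / \<epsilon>) / 2 * sqnorm d + 1 / (2 * (1 / \<epsilon>)) * sqnorm ry"
    using \<epsilon> by (intro cmod_pairing_weighted_le d ry) simp
  also have "\<dots> \<le> (1 / \<epsilon>) / 2 * (\<epsilon>\<^sup>2 * (norm a)\<^sup>2) + 1 / (2 * (1 / \<epsilon>)) * sqnorm ry"
    using \<epsilon> by (intro add_right_mono mult_left_mono d_le) simp
  also have "\<dots> = \<epsilon> / 2 * ((norm a)\<^sup>2 + sqnorm ry)"
    using \<epsilon> by (simp add: field_simps power2_eq_square)
  finally have first: "cmod (pairing d ry) \<le> \<epsilon> / 2 * ((norm a)\<^sup>2 + sqnorm ry)" .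
  define w where "w n = cinner (g n) b" for n
  have w: "square_summable w"
    unfolding w_def by (rule square_summable_cinner[OF g])
  have "sqnorm w \<le> (norm b)\<^sup>2 * sqnorm g"
    unfolding w_def by (intro sqnorm_le[OF g]) (metis cmod_cinner_le mult.commute)
  also have "\<dots> \<le> \<beta> * (\<epsilon>\<^sup>2 * \<beta>)"
    unfolding \<beta>_def[symmetric] using \<beta> by (intro mult_left_mono g_le) simp
  finally have w_le: "sqnorm w \<le> \<beta> * (\<epsilon>\<^sup>2 * \<beta>)" .
  \<comment> \<open>The coefficients of the rank-one value are those of \<open>\<Sum>n. \<xi>\<^sub>n \<langle>a, y\<^sub>n\<rangle>\<close> scaled by \<open>\<beta>\<close>, up to \<open>w\<close>.\<close>
  have "cinner (x n) b = w n + complex_of_real \<beta> * \<xi> n" for n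
  proof -
    have "cinner (x n) b = cinner (q \<cdot> x n) b"
      by (simp add: proj_op_selfadjoint b(3))
    also have "\<dots> = cinner (g n + \<xi> n *\<^sub>C b) b"
      by (simp add: g_def)
    finally show ?thesis
      by (simp add: cinner_add_left cinner_scaleC_left w_def cinner_self \<beta>_def mult.commute)
  qed
  then have "(\<Sum>n. cinner (x n) b * cinner a (y n)) = pairing (\<lambda>n. w n + complex_of_real \<beta> *\<^sub>C \<xi> n) v"
    unfolding pairing_def v_def
    by (simp add: cinner_complex_def scaleC_complex_def flip: cinner_commute[of a])
  also have "\<dots> = pairing w v + \<beta> * pairing \<xi> v"
    by (simp add: pairing_add_left[OF w square_summable_scaleC[OF \<xi>] v] pairing_scaleC_left[OF \<xi> v])
  finally have "\<beta> * pairing \<xi> v = - pairing w v"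
    using annih[OF F(1) a(2) b(2)] by (simp add: eq_neg_iff_add_eq_0 add.commute)
  then have "\<beta> * cmod (pairing \<xi> v) = cmod (pairing w v)"
    using \<beta> arg_cong[of _ _ cmod] by (metis abs_of_pos norm_minus_cancel norm_mult norm_of_real)
  \<comment> \<open>This weight makes the bounds for the two terms of the weighted inequality equal to \<open>\<beta> \<epsilon> / 2\<close> times
      \<open>\<parallel>a\<parallel>\<^sup>2\<close> and \<open>\<beta> \<epsilon> / 2\<close> times the squared norm of \<open>ry\<close>.\<close>
  also define t where "t = (norm a)\<^sup>2 / (\<beta> * \<epsilon>)"
  have t: "t > 0"
    using a(1) \<beta> \<epsilon> by (simp add: t_def)
  have "cmod (pairing w v) \<le> t / 2 * sqnorm w + 1 / (2 * t) * sqnorm v"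
    by (rule cmod_pairing_weighted_le[OF w v t])
  also have "\<dots> \<le> t / 2 * (\<beta> * (\<epsilon>\<^sup>2 * \<beta>)) + 1 / (2 * t) * ((norm a)\<^sup>2 * sqnorm ry)"
    using t by (intro add_mono mult_left_mono w_le v_le) simp_all
  also have "\<dots> = \<beta> * (\<epsilon> / 2 * ((norm a)\<^sup>2 + sqnorm ry))"
    using \<beta> \<epsilon> a(1) by (simp add: t_def field_simps power2_eq_square)
  finally have "cmod (pairing \<xi> v) \<le> \<epsilon> / 2 * ((norm a)\<^sup>2 + sqnorm ry)"
    using \<beta> by simp
  with first have "cmod (pairing (\<lambda>n. r \<cdot> x n) y) \<le> \<epsilon> * ((norm a)\<^sup>2 + sqnorm ry)"
    unfolding split using norm_triangle_ineq[of "pairing d ry" "pairing \<xi> v"]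
    by (simp add: field_simps)
  then show ?thesis
    using r(1) a(1) by (intro bexI[of _ r]) (simp_all add: a_def ry_def[abs_def])
qed

text \<open>
  The sum is the value of the functional \<open>S \<mapsto> \<Sum>n. \<langle>S x\<^sub>n, y\<^sub>n\<rangle>\<close> at the operator \<open>z \<mapsto> \<langle>z, b\<rangle> a\<close>.
\<close>

definition annihilates_rank_ones ::
  "'a::complex_hilbert proj set \<Rightarrow> (nat \<Rightarrow> 'a) \<Rightarrow> (nat \<Rightarrow> 'a) \<Rightarrow> bool" where
  "annihilates_rank_ones L x y \<longleftrightarrow> (\<forall>F\<in>L. \<forall>a b. F \<cdot> a = a \<longrightarrow> minus_proj L F \<cdot> b = 0 \<longrightarrow>
     (\<Sum>n. cinner (x n) b * cinner a (y n)) = 0)"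

text \<open>
  Exhaustion by the projections \<open>e\<close> commuting with \<open>L\<close> on which the functional is small relative to the
  masses of \<open>x\<close> and \<open>y\<close>. If a maximal such \<open>e\<close> did not fix some \<open>x\<^sub>k\<close>, consider the remainder
  \<open>h = x\<^sub>k - e x\<^sub>k\<close> and the closure \<open>M\<close> of the set of all vectors orthogonal to \<open>e\<close> that are locally
  proportional to \<open>h\<close>, a subspace reducing for the bicommutant of \<open>L\<close>. Compressed to \<open>M\<close> the functional still annihilates the rank-one operators, and the
  local estimate yields a projection, orthogonal to \<open>e\<close>, by which \<open>e\<close> can be enlarged.
\<close>

lemma annihilator_bound:
  assumes L: "subspace_lattice L" and comm: "commutative_lattice L" and cd: "completely_distributive L"
    and x: "square_summable x" and y: "square_summable y" and annih: "annihilates_rank_ones L x y"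
    and \<epsilon>: "\<epsilon> > 0"
  shows "cmod (pairing x y) \<le> \<epsilon> * (sqnorm x + sqnorm y)"
proof -
  define C where "C = proj_commutant L"
  have LC: "L \<subseteq> C"
  proof
    fix E assume E: "E \<in> L"
    have "E \<cdot> F \<cdot> z = F \<cdot> E \<cdot> z" if "F \<in> L" for F z
    proof -
      have "proj_op E o\<^sub>L proj_op F = proj_op F o\<^sub>L proj_op E"
        using comm E that by (simp add: commutative_lattice_def)
      then show ?thesis
        by (metis blinfun_apply_blinfun_compose)
    qed
    then show "E \<in> C"
      unfolding C_def by (rule proj_commutantI)
  qed
  \<comment> \<open>\<open>C\<close> and \<open>proj_commutant C\<close> are the commutant and the bicommutant of the lattice; the latter is
      abelian because the former contains the lattice.\<close>
  have BC: "proj_commutant C \<subseteq> C"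
    using LC unfolding C_def proj_commutant_def by blast
  have LB: "L \<subseteq> proj_commutant C"
    unfolding C_def proj_commutant_def using commuting_sym by blast
  interpret abelian_commutant C
    by unfold_locales (use BC in \<open>auto simp: proj_commutant_def\<close>)
  obtain e where e: "e \<in> C"
    and e_le: "cmod (pairing (\<lambda>n. e \<cdot> x n) y) \<le> \<epsilon> * (sqnorm (\<lambda>n. e \<cdot> x n) + sqnorm (\<lambda>n. e \<cdot> y n))"
    and max: "\<And>f. f \<in> C \<Longrightarrow>
      cmod (pairing (\<lambda>n. f \<cdot> x n) y) \<le> \<epsilon> * (sqnorm (\<lambda>n. f \<cdot> x n) + sqnorm (\<lambda>n. f \<cdot> y n)) \<Longrightarrow>
      e \<le> f \<Longrightarrow> f = e"
    unfolding C_def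
  proof (rule maximal_proj_in_commutant[of "\<lambda>e. cmod (pairing (\<lambda>n. e \<cdot> x n) y)"
        "\<lambda>e. \<epsilon> * (sqnorm (\<lambda>n. e \<cdot> x n) + sqnorm (\<lambda>n. e \<cdot> y n))" L])
    fix K :: "'a proj set" assume K: "proj_chain K"
    show "((\<lambda>e. cmod (pairing (\<lambda>n. e \<cdot> x n) y)) \<longlongrightarrow> cmod (pairing (\<lambda>n. Sup K \<cdot> x n) y)) (chain_filter K)"
      by (intro tendsto_norm tendsto_pairing_Sup_chain K x y)
    show "((\<lambda>e. \<epsilon> * (sqnorm (\<lambda>n. e \<cdot> x n) + sqnorm (\<lambda>n. e \<cdot> y n))) \<longlongrightarrow>
        \<epsilon> * (sqnorm (\<lambda>n. Sup K \<cdot> x n) + sqnorm (\<lambda>n. Sup K \<cdot> y n))) (chain_filter K)"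
      by (intro tendsto_mult tendsto_add tendsto_const tendsto_sqnorm_Sup_chain K x y)
  qed (simp_all add: sqnorm_def pairing_def)
  have e_all: "e \<cdot> x k = x k" for k
  proof (rule ccontr)
    assume "e \<cdot> x k \<noteq> x k"
    define h where "h = x k - e \<cdot> x k"
    have h: "h \<noteq> 0" "e \<cdot> h = 0"
      using \<open>e \<cdot> x k \<noteq> x k\<close> by (simp_all add: h_def blinfun.diff_right)
    define M where "M = closure (locally_proportional h \<inter> {z. e \<cdot> z = 0})"
    have M: "closed_csubspace M"
      unfolding M_def
      by (rule closed_csubspace_closure)
        (auto simp: locally_proportional_zero locally_proportional_add locally_proportional_scaleC
          blinfun.add_right blinfun.zero_right proj_op_scaleC)
    define P where "P = proj_onto M"
    have P: "prange P = M"
      unfolding P_def by (rule prange_proj_onto[OF M])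
    have P_commute: "P \<cdot> f \<cdot> z = f \<cdot> P \<cdot> z" if f: "f \<in> B" for f z
    proof -
      have ef: "e \<cdot> f \<cdot> z = f \<cdot> e \<cdot> z" for z
        using proj_commutantD[OF f e] by simp
      have "commuting P f"
      proof (rule commutingI_invariant)
        fix z assume "z \<in> prange P"
        then obtain s where s: "\<forall>n. s n \<in> locally_proportional h \<inter> {z. e \<cdot> z = 0}" "s \<longlonglongrightarrow> z"
          unfolding P M_def closure_sequential by blast
        have "f \<cdot> s n \<in> locally_proportional h \<inter> {z. e \<cdot> z = 0}" for n
          using s(1) locally_proportional_proj[OF _ f] by (auto simp: ef blinfun.zero_right)
        moreover have "(\<lambda>n. f \<cdot> s n) \<longlonglongrightarrow> f \<cdot> z"
          by (rule bounded_linear.tendsto[OF blinfun.bounded_linear_right s(2)])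
        ultimately show "f \<cdot> z \<in> prange P"
          unfolding P M_def closure_sequential by (intro exI[of _ "\<lambda>n. f \<cdot> s n"]) blast
      qed
      then show ?thesis
        by (rule commutingD)
    qed
    have eP: "e \<cdot> P \<cdot> z = 0" for z
    proof -
      have "M \<subseteq> {z. e \<cdot> z = 0}"
        unfolding M_def
        by (intro closure_minimal closed_Collect_eq blinfun.continuous_on continuous_on_id continuous_on_const)
          auto
      then show ?thesis
        using P proj_op_mem_prange by blast
    qed
    have Pe: "P \<cdot> e \<cdot> z = 0" for z
      by (rule eq_zeroI_cinner) (simp add: proj_op_selfadjoint eP)
    have "h \<in> locally_proportional h \<inter> {z. e \<cdot> z = 0}"
      using locally_proportional_self h(2) by simp
    then have "h \<in> M"
      unfolding M_def by (rule subsetD[OF closure_subset])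
    then have Ph: "P \<cdot> h = h"
      unfolding P[symmetric] mem_prange_iff .
    \<comment> \<open>Hence \<open>\<parallel>r h\<parallel>\<^sup>2\<close>, which bounds the functional on \<open>r P\<close>, is part of the mass of \<open>x\<close> on \<open>r P\<close>.\<close>
    have Pxk: "P \<cdot> x k = h"
      using Ph by (simp add: h_def blinfun.diff_right Pe)
    have "\<exists>r\<in>B. r \<cdot> h \<noteq> 0 \<and> cmod (pairing (\<lambda>n. r \<cdot> P \<cdot> x n) (\<lambda>n. P \<cdot> y n)) \<le>
        \<epsilon> * ((norm (r \<cdot> h))\<^sup>2 + sqnorm (\<lambda>n. r \<cdot> P \<cdot> y n))"
    proof (rule local_estimate[of L "minus_proj L"])
      show "\<exists>F\<in>L. F \<cdot> k \<noteq> 0 \<and> minus_proj L F \<cdot> k \<noteq> k" if "k \<noteq> 0" for k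
        by (rule completely_distributive_separates[OF L cd that])
      show "minus_proj L F \<in> B" for F
        using minus_proj_mem[OF L] LB by blast
      then have mB: "P \<cdot> minus_proj L F \<cdot> z = minus_proj L F \<cdot> P \<cdot> z" for F z
        by (rule P_commute)
      show "(\<Sum>n. cinner (P \<cdot> x n) b * cinner a (P \<cdot> y n)) = 0"
        if F: "F \<in> L" and a: "F \<cdot> a = a" and b: "minus_proj L F \<cdot> b = 0" for F a b
      proof -
        have "F \<cdot> P \<cdot> a = P \<cdot> a"
          using P_commute[of F a] LB F a by auto
        moreover have "minus_proj L F \<cdot> P \<cdot> b = 0"
          using mB[of F b] b by (simp add: blinfun.zero_right)
        ultimately have "(\<Sum>n. cinner (x n) (P \<cdot> b) * cinner (P \<cdot> a) (y n)) = 0"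
          using annih F unfolding annihilates_rank_ones_def by blast
        then show ?thesis
          by (simp add: proj_op_selfadjoint)
      qed
      show "P \<cdot> x n \<in> closure (locally_proportional h)" for n
        using P proj_op_mem_prange closure_mono[OF Int_lower1] unfolding M_def by blast
    qed (use LB h \<epsilon> x y in \<open>auto intro: square_summable_blinfun\<close>)
    then obtain r where r: "r \<in> B" "r \<cdot> h \<noteq> 0"
      and r_le: "cmod (pairing (\<lambda>n. r \<cdot> P \<cdot> x n) (\<lambda>n. P \<cdot> y n)) \<le>
        \<epsilon> * ((norm (r \<cdot> h))\<^sup>2 + sqnorm (\<lambda>n. r \<cdot> P \<cdot> y n))"
      by blast
    define f where "f = inf r P"
    have rP: "commuting r P"
      unfolding commuting_def using P_commute[OF r(1)] by simp
    have f_apply: "f \<cdot> z = r \<cdot> P \<cdot> z" for z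
      unfolding f_def by (rule inf_proj_apply[OF rP])
    have "P \<in> C"
      unfolding C_def by (rule proj_commutantI) (rule P_commute[OF subsetD[OF LB]])
    then have fC: "f \<in> C"
      using subsetD[OF BC r(1)] unfolding f_def C_def by (intro inf_in_proj_commutant rP)
    have ef: "e \<cdot> f \<cdot> z = 0" for z
      using proj_commutantD[OF r(1) e, of "P \<cdot> z"] by (simp add: f_apply eP blinfun.zero_right)
    have "cinner (r \<cdot> P \<cdot> x n) (P \<cdot> y n) = cinner (f \<cdot> x n) (y n)" for n
      using proj_op_selfadjoint[of P "r \<cdot> P \<cdot> x n" "y n"]
      by (simp add: P_commute[OF r(1)] f_apply)
    then have "cmod (pairing (\<lambda>n. f \<cdot> x n) y) \<le>
        \<epsilon> * ((norm (r \<cdot> h))\<^sup>2 + sqnorm (\<lambda>n. f \<cdot> y n))"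
      using r_le by (simp add: pairing_def f_apply)
    also have "(norm (r \<cdot> h))\<^sup>2 \<le> sqnorm (\<lambda>n. f \<cdot> x n)"
      using power2_norm_le_sqnorm[OF square_summable_blinfun[OF x, of "proj_op f"], of k]
      by (simp add: f_apply Pxk)
    finally have f_le: "cmod (pairing (\<lambda>n. f \<cdot> x n) y) \<le>
        \<epsilon> * (sqnorm (\<lambda>n. f \<cdot> x n) + sqnorm (\<lambda>n. f \<cdot> y n))"
      using \<epsilon> by simp
    have "sup e f = e"
    proof (rule max)
      show "sup e f \<in> C"
        using e fC ef unfolding C_def by (intro sup_in_proj_commutant)
      show "cmod (pairing (\<lambda>n. sup e f \<cdot> x n) y) \<le>
          \<epsilon> * (sqnorm (\<lambda>n. sup e f \<cdot> x n) + sqnorm (\<lambda>n. sup e f \<cdot> y n))"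
        using e_le f_le norm_triangle_ineq[of "pairing (\<lambda>n. e \<cdot> x n) y" "pairing (\<lambda>n. f \<cdot> x n) y"]
        by (simp add: pairing_sup_orthogonal[OF ef x y] sqnorm_sup_orthogonal[OF ef] x y distrib_left)
    qed simp
    then have "f \<cdot> x k = 0"
      using sup_orthogonal_apply[OF ef, of "x k"] by simp
    then show False
      using r(2) by (simp add: f_apply Pxk)
  qed
  have "sqnorm (\<lambda>n. e \<cdot> y n) \<le> sqnorm y"
    using sqnorm_le[OF y, of "\<lambda>n. e \<cdot> y n" 1] by (simp add: norm_proj_le)
  then have "\<epsilon> * (sqnorm x + sqnorm (\<lambda>n. e \<cdot> y n)) \<le> \<epsilon> * (sqnorm x + sqnorm y)"
    using \<epsilon> by simp
  then show ?thesis
    using e_le by (simp add: e_all)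
qed

text \<open>
  The density theorem for rank-one operators in dual form: by separation it says that the identity
  is an ultraweak limit of linear combinations of rank-one operators of the algebra.
\<close>

lemma pairing_eq_zero_if_annihilates_rank_ones:
  assumes "subspace_lattice L" "commutative_lattice L" "completely_distributive L"
    and x: "square_summable x" and y: "square_summable y" and "annihilates_rank_ones L x y"
  shows "pairing x y = 0"
proof -
  have "cmod (pairing x y) \<le> 0"
  proof (rule field_le_epsilon)
    fix \<delta> :: real assume \<delta>: "\<delta> > 0"
    let ?K = "sqnorm x + sqnorm y"
    have K: "?K \<ge> 0"
      using sqnorm_nonneg[OF x] sqnorm_nonneg[OF y] by simp
    have "cmod (pairing x y) \<le> \<delta> / (?K + 1) * ?K"
      using assms \<delta> K by (intro annihilator_bound) simp_all
    also have "\<dots> \<le> \<delta>"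
      using \<delta> K by (simp add: field_simps)
    finally show "cmod (pairing x y) \<le> 0 + \<delta>"
      by simp
  qed
  then show ?thesis
    by simp
qed

section \<open>Separation in the ultraweak topology\<close>

text \<open>
  Finite-dimensional duality without matrices. One functional that does not vanish on \<open>U\<close> is removed
  at a time, by passing to its kernel in \<open>U\<close> and correcting \<open>T\<close> by a multiple of an element \<open>u0\<close> of \<open>U\<close> on which it
  takes the value 1.
\<close>

lemma separation_by_finitely_many_functionals:
  fixes \<F> :: "(('a::complex_hilbert \<Rightarrow>\<^sub>L 'a) \<Rightarrow> complex) set"
  assumes add: "\<And>f S T. f \<in> \<F> \<Longrightarrow> f (S + T) = f S + f T"
    and scale: "\<And>f c S. f \<in> \<F> \<Longrightarrow> f (op_scaleC c S) = c * f S"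
    and comb: "\<And>f g c. f \<in> \<F> \<Longrightarrow> g \<in> \<F> \<Longrightarrow> (\<lambda>S. f S + c * g S) \<in> \<F>"
  assumes "op_subspace U" and "\<And>f. f \<in> \<F> \<Longrightarrow> (\<And>S. S \<in> U \<Longrightarrow> f S = 0) \<Longrightarrow> f T = 0"
    and "set fs \<subseteq> \<F>"
  shows "\<exists>u\<in>U. \<forall>f\<in>set fs. f u = f T"
  using assms(4-)
proof (induction fs arbitrary: U T)
  case Nil
  then show ?case
    by (auto simp: op_subspace_def)
next
  case (Cons f fs)
  have f: "f \<in> \<F>" and fs: "set fs \<subseteq> \<F>"
    using Cons.prems(3) by simp_all
  show ?case
  proof (cases "\<forall>S\<in>U. f S = 0")
    case True
    then have "f T = 0"
      using Cons.prems(2)[OF f] by blast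
    moreover have "\<exists>u\<in>U. \<forall>f\<in>set fs. f u = f T"
      by (rule Cons.IH[OF Cons.prems(1) _ fs]) (rule Cons.prems(2))
    then obtain u where "u \<in> U" "\<forall>f\<in>set fs. f u = f T"
      by blast
    ultimately show ?thesis
      using True by (intro bexI[of _ u]) auto
  next
    case False
    then obtain S0 where S0: "S0 \<in> U" "f S0 \<noteq> 0"
      by blast
    define u0 where "u0 = op_scaleC (1 / f S0) S0"
    have u0: "u0 \<in> U" "f u0 = 1"
      using S0 Cons.prems(1) by (auto simp: u0_def scale[OF f] op_subspace_def)
    define V where "V = {S \<in> U. f S = 0}"
    have sub: "op_scaleC c u \<in> U" if "u \<in> U" for c u
      using Cons.prems(1) that by (simp add: op_subspace_def)
    have f0: "g 0 = 0" if "g \<in> \<F>" for g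
      using add[OF that, of 0 0] by simp
    have V: "op_subspace V"
      using Cons.prems(1) by (auto simp: op_subspace_def V_def add[OF f] scale[OF f] f0[OF f])
    define T' where "T' = T + op_scaleC (- f T) u0"
    have "g T' = 0" if g: "g \<in> \<F>" and gV: "\<And>S. S \<in> V \<Longrightarrow> g S = 0" for g
    proof -
      \<comment> \<open>A functional vanishing on the kernel \<open>V\<close> extends to one vanishing on \<open>U\<close>, after subtracting a
          multiple of \<open>f\<close>.\<close>
      let ?k = "\<lambda>S. g S + (- g u0) * f S"
      have "?k S = 0" if "S \<in> U" for S
      proof -
        have "S + op_scaleC (- f S) u0 \<in> V"
          using that u0 sub[OF u0(1)] Cons.prems(1)
          by (auto simp: V_def add[OF f] scale[OF f] op_subspace_def)
        then have "g (S + op_scaleC (- f S) u0) = 0"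
          by (rule gV)
        then show ?thesis
          by (simp add: add[OF g] scale[OF g])
      qed
      then have "?k T = 0"
        using Cons.prems(2)[OF comb[OF g f]] by blast
      then show ?thesis
        by (simp add: T'_def add[OF g] scale[OF g])
    qed
    then have "\<exists>u\<in>V. \<forall>g\<in>set fs. g u = g T'"
      by (rule Cons.IH[OF V _ fs])
    then obtain u where u: "u \<in> V" "\<forall>g\<in>set fs. g u = g T'"
      by blast
    let ?u = "u + op_scaleC (f T) u0"
    have "?u \<in> U"
      using u(1) sub[OF u0(1)] Cons.prems(1) by (simp add: V_def op_subspace_def)
    moreover have "f ?u = f T"
      using u(1) by (simp add: V_def add[OF f] scale[OF f] u0(2))
    moreover have "g ?u = g T" if "g \<in> set fs" for g
    proof -
      have "g \<in> \<F>"
        using that fs by blast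
      then show ?thesis
        using bspec[OF u(2) that] by (simp add: T'_def add scale)
    qed
    ultimately show ?thesis
      by (intro bexI[of _ ?u]) auto
  qed
qed

definition ultraweak_functionals :: "(('a::complex_hilbert \<Rightarrow>\<^sub>L 'a) \<Rightarrow> complex) set" where
  "ultraweak_functionals = {\<lambda>S. pairing (\<lambda>n. blinfun_apply S (x n)) y | x y.
     square_summable x \<and> square_summable y}"

lemma sums_interleave:
  fixes f g :: "nat \<Rightarrow> complex"
  assumes "f sums s" "g sums t"
  shows "(\<lambda>n. if even n then f (n div 2) else g ((n - 1) div 2)) sums (t + s)"
proof -
  have "(\<lambda>n. if even n then Re (f (n div 2)) else Re (g ((n - 1) div 2))) sums (Re t + Re s)"
    "(\<lambda>n. if even n then Im (f (n div 2)) else Im (g ((n - 1) div 2))) sums (Im t + Im s)"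
    using assms by (auto intro!: sums_if simp: sums_complex_iff)
  then show ?thesis
    by (simp add: sums_complex_iff if_distrib cong: if_cong)
qed

lemma summable_interleave:
  fixes f g :: "nat \<Rightarrow> real"
  assumes "summable f" "summable g"
  shows "summable (\<lambda>n. if even n then f (n div 2) else g ((n - 1) div 2))"
  using assms sums_if unfolding summable_def by blast

lemma square_summable_interleave:
  assumes "square_summable x" "square_summable y"
  shows "square_summable (\<lambda>n. if even n then x (n div 2) else y ((n - 1) div 2))"
  using summable_interleave[OF assms[unfolded square_summable_def]]
  unfolding square_summable_def by (simp add: if_distrib[of "\<lambda>v. (norm v)\<^sup>2"] cong: if_cong)

lemma pairing_interleave:
  assumes "square_summable x" "square_summable y" "square_summable x'" "square_summable y'"
  shows "pairing (\<lambda>n. if even n then x (n div 2) else x' ((n - 1) div 2))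
      (\<lambda>n. if even n then y (n div 2) else y' ((n - 1) div 2)) = pairing x y + pairing x' y'"
proof -
  have "(\<lambda>n. if even n then cinner (x (n div 2)) (y (n div 2))
      else cinner (x' ((n - 1) div 2)) (y' ((n - 1) div 2))) sums (pairing x' y' + pairing x y)"
    unfolding pairing_def by (intro sums_interleave summable_sums summable_pairing assms)
  moreover have "(\<lambda>n. cinner (if even n then x (n div 2) else x' ((n - 1) div 2))
      (if even n then y (n div 2) else y' ((n - 1) div 2))) =
      (\<lambda>n. if even n then cinner (x (n div 2)) (y (n div 2))
      else cinner (x' ((n - 1) div 2)) (y' ((n - 1) div 2)))"
    by auto
  ultimately show ?thesis
    unfolding pairing_def by (simp add: sums_iff add.commute)
qed

text \<open>
  Interleaving two square-summable sequences into one shows that these functionals form a vector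
  space.
\<close>

lemma ultraweak_functionals_combination:
  assumes "f \<in> ultraweak_functionals" "g \<in> ultraweak_functionals"
  shows "(\<lambda>S. f S + c * g S) \<in> ultraweak_functionals"
proof -
  obtain x y x' y' where xy: "square_summable x" "square_summable y"
    "square_summable x'" "square_summable y'"
    and f: "f = (\<lambda>S. pairing (\<lambda>n. blinfun_apply S (x n)) y)"
    and g: "g = (\<lambda>S. pairing (\<lambda>n. blinfun_apply S (x' n)) y')"
    using assms unfolding ultraweak_functionals_def by blast
  let ?y' = "\<lambda>n. cnj c *\<^sub>C y' n"
  have y': "square_summable ?y'"
    by (rule square_summable_scaleC[OF xy(4)])
  let ?X = "\<lambda>n. if even n then x (n div 2) else x' ((n - 1) div 2)"
  let ?Y = "\<lambda>n. if even n then y (n div 2) else ?y' ((n - 1) div 2)"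
  have "f S + c * g S = pairing (\<lambda>n. blinfun_apply S (?X n)) ?Y" for S
  proof -
    have "c * g S = pairing (\<lambda>n. blinfun_apply S (x' n)) ?y'"
      unfolding g pairing_scaleC_left[OF square_summable_blinfun[OF xy(3)] xy(4), symmetric]
      by (simp add: pairing_def cinner_scaleC_left cinner_scaleC_right)
    then show ?thesis
      using pairing_interleave[OF square_summable_blinfun[OF xy(1)] xy(2)
          square_summable_blinfun[OF xy(3)] y', of S S]
      by (simp add: f if_distrib cong: if_cong)
  qed
  then show ?thesis
    unfolding ultraweak_functionals_def
    by (intro CollectI exI[of _ ?X] exI[of _ ?Y] conjI ext
        square_summable_interleave[OF xy(1,3)] square_summable_interleave[OF xy(2) y'])
qed

text \<open>
  Open sets are unions of finite intersections of subbasic ones, and membership in a subbasic set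
  depends on the value of one functional only.
\<close>

lemma sigma_weak_neighbourhood:
  assumes "openin sigma_weak W" "T \<in> W"
  shows "\<exists>fs. set fs \<subseteq> ultraweak_functionals \<and> (\<forall>S\<in>BH. (\<forall>f\<in>set fs. f S = f T) \<longrightarrow> S \<in> W)"
proof -
  have "generate_topology_on {{T \<in> BH. (\<Sum>n. cinner (blinfun_apply T (x n)) (y n)) \<in> V} | x y V.
      summable (\<lambda>n. (norm (x n))\<^sup>2) \<and> summable (\<lambda>n. (norm (y n))\<^sup>2) \<and> open V} W"
    using assms(1) unfolding sigma_weak_def by (rule openin_topology_generated_by)
  then show ?thesis
    using assms(2)
  proof (induction rule: generate_topology_on.induct)
    case (Int a b)
    then obtain fs gs where "set fs \<subseteq> ultraweak_functionals" "set gs \<subseteq> ultraweak_functionals"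
      "\<forall>S\<in>BH. (\<forall>f\<in>set fs. f S = f T) \<longrightarrow> S \<in> a" "\<forall>S\<in>BH. (\<forall>f\<in>set gs. f S = f T) \<longrightarrow> S \<in> b"
      by blast
    then show ?case
      by (intro exI[of _ "fs @ gs"]) auto
  next
    case (UN K)
    then show ?case
      by (meson UnionE UnionI)
  next
    case (Basis s)
    then obtain x y V where s: "s = {T \<in> BH. (\<Sum>n. cinner (blinfun_apply T (x n)) (y n)) \<in> V}"
      and xy: "square_summable x" "square_summable y"
      unfolding square_summable_def by blast
    let ?f = "\<lambda>S. pairing (\<lambda>n. blinfun_apply S (x n)) y"
    have "?f \<in> ultraweak_functionals"
      using xy unfolding ultraweak_functionals_def by blast
    then show ?case
      using Basis.prems by (intro exI[of _ "[?f]"]) (simp add: s pairing_def)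
  qed simp
qed

text \<open>
  The Hahn-Banach separation of a point from an ultraweakly closed subspace. For a topology that is
  generated by a vector space of functionals it reduces to finitely many functionals at a time.
\<close>

lemma sigma_weak_closed_memI:
  assumes U: "op_subspace U" and cl: "closedin sigma_weak U" and T: "T \<in> BH"
    and ann: "\<And>x y. square_summable x \<Longrightarrow> square_summable y \<Longrightarrow>
      (\<And>S. S \<in> U \<Longrightarrow> pairing (\<lambda>n. blinfun_apply S (x n)) y = 0) \<Longrightarrow>
      pairing (\<lambda>n. blinfun_apply T (x n)) y = 0"
  shows "T \<in> U"
proof (rule ccontr)
  assume "T \<notin> U"
  then have mem: "T \<in> BH - U"
    using T by simp
  have "openin sigma_weak (BH - U)"
    using cl by (simp add: closedin_def topspace_sigma_weak)
  from sigma_weak_neighbourhood[OF this mem]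
  obtain fs where fs: "set fs \<subseteq> ultraweak_functionals"
    "\<forall>S\<in>BH. (\<forall>f\<in>set fs. f S = f T) \<longrightarrow> S \<in> BH - U"
    by blast
  have "\<exists>u\<in>U. \<forall>f\<in>set fs. f u = f T"
  proof (rule separation_by_finitely_many_functionals[where \<F> = ultraweak_functionals])
    fix f :: "('a \<Rightarrow>\<^sub>L 'a) \<Rightarrow> complex" and c and R S :: "'a \<Rightarrow>\<^sub>L 'a"
    assume "f \<in> ultraweak_functionals"
    then obtain x y where f: "f = (\<lambda>S. pairing (\<lambda>n. blinfun_apply S (x n)) y)"
      and xy: "square_summable x" "square_summable y"
      unfolding ultraweak_functionals_def by blast
    show "f (R + S) = f R + f S"
      by (simp add: f blinfun.add_left pairing_add_left square_summable_blinfun xy)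
    show "f (op_scaleC c S) = c * f S"
      by (simp add: f pairing_scaleC_left square_summable_blinfun xy)
  next
    fix f :: "('a \<Rightarrow>\<^sub>L 'a) \<Rightarrow> complex"
    assume "f \<in> ultraweak_functionals" and zero: "\<And>S. S \<in> U \<Longrightarrow> f S = 0"
    then obtain x y where f: "f = (\<lambda>S. pairing (\<lambda>n. blinfun_apply S (x n)) y)"
      and xy: "square_summable x" "square_summable y"
      unfolding ultraweak_functionals_def by blast
    show "f T = 0"
      unfolding f by (rule ann[OF xy zero[unfolded f]])
  qed (use U fs(1) ultraweak_functionals_combination in auto)
  then show False
    using fs(2) U unfolding op_subspace_def by blast
qed

section \<open>Adjoints and rank-one operators\<close>

lemma riesz_representation:
  fixes f :: "'a::complex_hilbert \<Rightarrow> complex"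
  assumes f: "bounded_linear f" and fC: "\<And>c x. f (c *\<^sub>C x) = c * f x"
  shows "\<exists>w. \<forall>z. f z = cinner z w"
proof (cases "\<forall>x. f x = 0")
  case True
  then show ?thesis
    by (intro exI[of _ 0]) simp
next
  case False
  then obtain x where x: "f x \<noteq> 0"
    by blast
  interpret f: bounded_linear f
    by (rule f)
  have "closed {z. f z = 0}"
    by (intro closed_Collect_eq f.continuous_on continuous_on_id continuous_on_const)
  then have M: "closed_csubspace {z. f z = 0}"
    by (simp add: closed_csubspace_def f.zero f.add fC)
  obtain m where m: "f m = 0" "\<And>z. f z = 0 \<Longrightarrow> cinner (x - m) z = 0"
    using nearest_point[OF M, of x] by blast
  define u where "u = x - m"
  have fu: "f u \<noteq> 0"
    using x m(1) by (simp add: u_def f.diff)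
  then have u: "u \<noteq> 0"
    using f.zero by auto
  have "f z = cinner z ((cnj (f u) / (norm u)\<^sup>2) *\<^sub>C u)" for z
  proof -
    have "f (f u *\<^sub>C z - f z *\<^sub>C u) = 0"
      by (simp add: f.diff fC)
    then have "cinner (f u *\<^sub>C z - f z *\<^sub>C u) u = 0"
      using m(2) cinner_eq_zero_commute unfolding u_def by blast
    then have "f u * cinner z u = f z * (norm u)\<^sup>2"
      by (simp add: cinner_diff_left cinner_scaleC_left cinner_self)
    then show ?thesis
      using u by (simp add: cinner_scaleC_right field_simps)
  qed
  then show ?thesis
    by blast
qed

text \<open>
  The norm bound is what keeps the image of a square-summable sequence square-summable.
\<close>

lemma ex_adjoint:
  assumes T: "T \<in> BH"
  obtains T' where "\<And>x y. cinner (blinfun_apply T x) y = cinner x (T' y)"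
    "\<And>y. norm (T' y) \<le> norm T * norm y"
proof -
  have "\<exists>w. \<forall>x. cinner (blinfun_apply T x) y = cinner x w" for y
  proof (rule riesz_representation)
    show "bounded_linear (\<lambda>x. cinner (blinfun_apply T x) y)"
      by (rule bounded_linear_compose[OF bounded_linear_cinner_left blinfun.bounded_linear_right])
    show "cinner (blinfun_apply T (c *\<^sub>C x)) y = c * cinner (blinfun_apply T x) y" for c x
      using T by (simp add: BH_def cinner_scaleC_left)
  qed
  then obtain T' where T': "\<And>x y. cinner (blinfun_apply T x) y = cinner x (T' y)"
    by metis
  have "norm (T' y) \<le> norm T * norm y" for y
  proof -
    have "(norm (T' y))\<^sup>2 = cmod (cinner (blinfun_apply T (T' y)) y)"
      unfolding T' cinner_self by (simp flip: of_real_power)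
    also have "\<dots> \<le> norm (blinfun_apply T (T' y)) * norm y"
      by (rule cmod_cinner_le)
    also have "\<dots> \<le> (norm T * norm (T' y)) * norm y"
      by (intro mult_right_mono norm_blinfun) simp
    finally have "norm (T' y) * norm (T' y) \<le> norm (T' y) * (norm T * norm y)"
      by (simp add: power2_eq_square mult_ac)
    then show ?thesis
      by (cases "norm (T' y) = 0") (simp_all add: mult_le_cancel_left)
  qed
  with T' show ?thesis
    using that by blast
qed

definition rank_one :: "'a::complex_hilbert \<Rightarrow> 'a \<Rightarrow> 'a \<Rightarrow>\<^sub>L 'a" where
  "rank_one a b = Blinfun (\<lambda>z. cinner z b *\<^sub>C a)"

lemma rank_one_apply [simp]: "blinfun_apply (rank_one a b) z = cinner z b *\<^sub>C a"
proof -
  have "bounded_linear (\<lambda>z. cinner z b *\<^sub>C a)"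
  proof (rule bounded_linear_intro[where K = "norm b * norm a"])
    show "norm (cinner z b *\<^sub>C a) \<le> norm z * (norm b * norm a)" for z
      using mult_right_mono[OF cmod_cinner_le[of z b] norm_ge_zero[of a]]
      by (simp add: norm_scaleC mult.assoc)
  qed (simp_all add: cinner_add_left scaleC_add_left scaleR_scaleC cinner_scaleC_left scaleC_scaleC)
  then show ?thesis
    by (simp add: rank_one_def bounded_linear_Blinfun_apply)
qed

text \<open>
  An element \<open>E\<close> of the lattice either contains \<open>F\<close>, and hence \<open>a\<close>, or it lies below \<open>F\<^sub>-\<close>, and then the
  operator vanishes on it.
\<close>

lemma rank_one_in_Alg:
  assumes F: "F \<in> L" and a: "F \<cdot> a = a" and b: "minus_proj L F \<cdot> b = 0"
  shows "rank_one a b \<in> Alg L"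
proof -
  have "maps_into (rank_one a b) E E" if E: "E \<in> L" for E
  proof (cases "F \<le> E")
    case True
    have "a \<in> prange F"
      using a by (simp add: mem_prange_iff)
    then have "a \<in> prange E"
      using True unfolding less_eq_proj_def by blast
    then show ?thesis
      using closed_csubspace_prange[of E] by (auto simp: maps_into_def closed_csubspace_def)
  next
    case False
    have "E \<le> minus_proj L F"
      unfolding minus_proj_def using E False by (intro Sup_upper) simp
    then have "E \<cdot> b = 0"
      using le_proj_apply(2)[of E "minus_proj L F" b] b by (simp add: blinfun.zero_right)
    then have "cinner z b = 0" if "z \<in> prange E" for z
      using proj_op_selfadjoint[of E z b] that by (simp add: mem_prange_iff)
    then show ?thesis
      using closed_csubspace_prange[of E] by (auto simp: maps_into_def closed_csubspace_def)
  qed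
  moreover have "rank_one a b \<in> BH"
    by (simp add: BH_def cinner_scaleC_left scaleC_scaleC)
  ultimately show ?thesis
    by (simp add: Alg_def)
qed

section \<open>Submodules\<close>

lemma blinfun_suminf_scaleC:
  assumes "S \<in> BH" "square_summable c" "square_summable x"
  shows "blinfun_apply S (\<Sum>n. c n *\<^sub>C x n) = (\<Sum>n. c n *\<^sub>C blinfun_apply S (x n))"
  using bounded_linear.suminf[OF blinfun.bounded_linear_right
      summable_scaleC_square_summable[OF assms(2,3)], of S] assms(1)
  by (simp add: BH_def)

text \<open>
  The rank-one operators \<open>z \<mapsto> \<langle>z, b\<rangle> a'\<close> with \<open>a'\<close> in \<open>F\<close> multiply \<open>U\<close> into itself, so the vectors \<open>S a'\<close> with
  \<open>S \<in> U\<close> are orthogonal to one vector \<open>w\<close>, depending on \<open>b\<close> and the functional. The orthogonality passes to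
  the closed span of these vectors, which contains \<open>T a\<close>.
\<close>

lemma right_submodule_annihilator:
  assumes U: "right_submodule (Alg L) U"
    and x: "square_summable x" and y: "square_summable y"
    and ann: "\<And>S. S \<in> U \<Longrightarrow> pairing (\<lambda>n. blinfun_apply S (x n)) y = 0"
    and F: "F \<in> L" and a: "F \<cdot> a = a" and b: "minus_proj L F \<cdot> b = 0"
    and T: "maps_into T F (Inf {G. \<forall>S\<in>U. maps_into S F G})"
  shows "(\<Sum>n. cinner (x n) b * cinner (blinfun_apply T a) (y n)) = 0"
proof -
  have c: "square_summable (\<lambda>n. cinner b (x n))"
    by (rule square_summable_cinner[OF x])
  define w where "w = (\<Sum>n. cinner b (x n) *\<^sub>C y n)"
  have w: "cinner z w = (\<Sum>n. cinner (x n) b * cinner z (y n))" for z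
  proof -
    have "summable (\<lambda>n. cinner b (x n) * cinner (y n) z)"
      using bounded_linear.summable[OF bounded_linear_cinner_left
          summable_scaleC_square_summable[OF c y], of z] by (simp add: cinner_scaleC_left)
    from bounded_linear.suminf[OF bounded_linear_cnj this]
    have "cnj (cinner w z) = (\<Sum>n. cnj (cinner b (x n) * cinner (y n) z))"
      unfolding w_def cinner_suminf_scaleC[OF c y] .
    then show ?thesis
      by (simp flip: cinner_commute)
  qed
  let ?G = "proj_onto {z. cinner z w = 0}"
  have G: "prange ?G = {z. cinner z w = 0}"
    by (rule prange_proj_onto[OF closed_csubspace_orthogonal])
  have "maps_into S F ?G" if S: "S \<in> U" for S
    unfolding maps_into_def G
  proof clarify
    fix a' assume "a' \<in> prange F"
    then have "rank_one a' b \<in> Alg L"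
      by (intro rank_one_in_Alg[OF F _ b]) (simp add: mem_prange_iff)
    then have "S o\<^sub>L rank_one a' b \<in> U"
      using U S unfolding right_submodule_def by blast
    from ann[OF this] have "(\<Sum>n. cinner (blinfun_apply S (cinner (x n) b *\<^sub>C a')) (y n)) = 0"
      by (simp add: pairing_def)
    moreover have "S \<in> BH"
      using U S unfolding right_submodule_def op_subspace_def by blast
    ultimately show "cinner (blinfun_apply S a') w = 0"
      unfolding w by (simp add: BH_def cinner_scaleC_left)
  qed
  then have "Inf {G. \<forall>S\<in>U. maps_into S F G} \<le> ?G"
    by (intro Inf_lower) simp
  moreover have "a \<in> prange F"
    unfolding mem_prange_iff by (rule a)
  then have "blinfun_apply T a \<in> prange (Inf {G. \<forall>S\<in>U. maps_into S F G})"
    using T unfolding maps_into_def by blast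
  ultimately have "blinfun_apply T a \<in> prange ?G"
    unfolding less_eq_proj_def by blast
  then show ?thesis
    unfolding G by (simp add: w)
qed

lemma closed_csubspace_preimage_prange:
  assumes "S \<in> BH"
  shows "closed_csubspace {z. blinfun_apply S z \<in> prange E}"
proof -
  have "closed (blinfun_apply S -` prange E)"
    using closed_csubspace_prange[of E]
    by (intro closed_vimage linear_continuous_on blinfun.bounded_linear_right)
      (simp add: closed_csubspace_def)
  then show ?thesis
    using closed_csubspace_prange[of E] assms
    by (simp add: closed_csubspace_def vimage_def blinfun.add_right blinfun.zero_right BH_def)
qed

lemma maps_into_Inf: "(\<And>G. G \<in> \<G> \<Longrightarrow> maps_into S E G) \<Longrightarrow> maps_into S E (Inf \<G>)"
  unfolding maps_into_def prange_Inf by blast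

lemma maps_into_Sup:
  assumes "S \<in> BH" "\<And>G. G \<in> \<G> \<Longrightarrow> maps_into S G E"
  shows "maps_into S (Sup \<G>) E"
proof -
  note range = prange_proj_onto[OF closed_csubspace_preimage_prange[OF assms(1), of E]]
  have "Sup \<G> \<le> proj_onto {z. blinfun_apply S z \<in> prange E}"
    using assms(2) by (intro Sup_least) (auto simp: less_eq_proj_def range maps_into_def)
  then show ?thesis
    by (auto simp: less_eq_proj_def range maps_into_def)
qed

lemma mem_prange_Sup_maps_into:
  assumes U: "op_subspace U" and v: "\<And>S. S \<in> U \<Longrightarrow> blinfun_apply S v \<in> prange E"
  shows "v \<in> prange (Sup {G. \<forall>S\<in>U. maps_into S G E})"
proof -
  let ?M = "\<Inter>S\<in>U. {z. blinfun_apply S z \<in> prange E}"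
  have "closed_csubspace ?M"
    using U by (intro closed_csubspace_Inter closed_csubspace_preimage_prange)
      (auto simp: op_subspace_def)
  then have range: "prange (proj_onto ?M) = ?M"
    by (rule prange_proj_onto)
  have "proj_onto ?M \<le> Sup {G. \<forall>S\<in>U. maps_into S G E}"
    by (intro Sup_upper CollectI ballI) (auto simp: maps_into_def range)
  moreover have "v \<in> prange (proj_onto ?M)"
    unfolding range using v by blast
  ultimately show ?thesis
    unfolding less_eq_proj_def by blast
qed

text \<open>
  The functional, evaluated at the product of a rank-one operator and \<open>S\<close>, is \<open>\<langle>S v, b\<rangle>\<close> for a vector \<open>v\<close>
  depending on \<open>a\<close>. It vanishes for \<open>S \<in> U\<close> and every \<open>b\<close> orthogonal to \<open>F\<^sub>-\<close>, so \<open>U\<close> maps \<open>v\<close> into \<open>F\<^sub>-\<close>. Therefore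
  \<open>T\<close> maps \<open>v\<close> into \<open>F\<^sub>-\<close> as well.
\<close>

lemma left_submodule_annihilator:
  assumes L: "subspace_lattice L" and U: "left_submodule (Alg L) U"
    and x: "square_summable x" and y: "square_summable y"
    and ann: "\<And>S. S \<in> U \<Longrightarrow> pairing (\<lambda>n. blinfun_apply S (x n)) y = 0"
    and F: "F \<in> L" and a: "F \<cdot> a = a" and b: "minus_proj L F \<cdot> b = 0"
    and TB: "T \<in> BH"
    and T: "maps_into T (Sup {G. \<forall>S\<in>U. maps_into S G (minus_proj L F)}) (minus_proj L F)"
  shows "(\<Sum>n. cinner (blinfun_apply T (x n)) b * cinner a (y n)) = 0"
proof -
  let ?E = "minus_proj L F"
  have U': "op_subspace U"
    using U by (simp add: left_submodule_def)
  have c: "square_summable (\<lambda>n. cinner a (y n))"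
    by (rule square_summable_cinner[OF y])
  define v where "v = (\<Sum>n. cinner a (y n) *\<^sub>C x n)"
  have v: "cinner (blinfun_apply S v) z = (\<Sum>n. cinner (blinfun_apply S (x n)) z * cinner a (y n))"
    if "S \<in> BH" for S z
    unfolding v_def blinfun_suminf_scaleC[OF that c x]
      cinner_suminf_scaleC[OF c square_summable_blinfun[OF x]]
    by (simp add: mult.commute)
  have "blinfun_apply S v \<in> prange ?E" if S: "S \<in> U" for S
  proof -
    have SB: "S \<in> BH"
      using U' S unfolding op_subspace_def by blast
    let ?z = "blinfun_apply S v - ?E \<cdot> blinfun_apply S v"
    have Ez: "?E \<cdot> ?z = 0"
      by (simp add: blinfun.diff_right)
    have "rank_one a ?z o\<^sub>L S \<in> U"
      using U S rank_one_in_Alg[OF F a Ez] unfolding left_submodule_def by blast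
    from ann[OF this] have "cinner (blinfun_apply S v) ?z = 0"
      unfolding v[OF SB] by (simp add: pairing_def cinner_scaleC_left)
    moreover have "cinner (?E \<cdot> blinfun_apply S v) ?z = 0"
      by (simp add: proj_op_selfadjoint Ez)
    ultimately have "cinner ?z ?z = 0"
      by (metis cinner_diff_left diff_zero)
    then show ?thesis
      by (simp add: cinner_self mem_prange_iff)
  qed
  then have "v \<in> prange (Sup {G. \<forall>S\<in>U. maps_into S G ?E})"
    by (rule mem_prange_Sup_maps_into[OF U'])
  then have "?E \<cdot> blinfun_apply T v = blinfun_apply T v"
    using T unfolding maps_into_def mem_prange_iff[symmetric] by blast
  then have "cinner (blinfun_apply T v) b = 0"
    using proj_op_selfadjoint[of ?E "blinfun_apply T v" b] b by simp
  then show ?thesis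
    by (simp add: v[OF TB])
qed

text \<open>
  The homomorphisms are the extreme choices: \<open>\<phi> E\<close> is the closed span of the images of \<open>E\<close> under \<open>U\<close>,
  and \<open>\<psi> E\<close> is the largest subspace that \<open>U\<close> maps into \<open>E\<close>. A functional \<open>S \<mapsto> \<Sum>n. \<langle>S x\<^sub>n, y\<^sub>n\<rangle>\<close> vanishing
  on \<open>U\<close> is evaluated at \<open>T\<close> by moving \<open>T\<close> to the other argument or keeping it in the first one, so that
  its value becomes the value at the identity of a functional that annihilates the rank-one operators.
\<close>

theorem corollary2p3:
  fixes L :: "'a::complex_hilbert proj set"
  assumes "subspace_lattice L"
    and "commutative_lattice L"
    and "completely_distributive L"
  shows "(\<forall>U. right_submodule (Alg L) U \<and> closedin sigma_weak U \<longrightarrow>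
            (\<exists>\<phi>\<in>Hom (Lat (Alg L)). U = {T \<in> BH. \<forall>E\<in>Lat (Alg L). maps_into T E (\<phi> E)})) \<and>
         (\<forall>U. left_submodule (Alg L) U \<and> closedin sigma_weak U \<longrightarrow>
            (\<exists>\<psi>\<in>Hom (Lat (Alg L)). U = {T \<in> BH. \<forall>E\<in>Lat (Alg L). maps_into T (\<psi> E) E}))"
proof (intro conjI allI impI; elim conjE)
  have Lat: "E \<in> Lat (Alg L)" if "E \<in> L" for E
    using that by (simp add: Lat_def Alg_def)
  note core = pairing_eq_zero_if_annihilates_rank_ones[OF assms]
  {
    fix U assume U: "right_submodule (Alg L) U" and cl: "closedin sigma_weak U"
    have U': "op_subspace U"
      using U by (simp add: right_submodule_def)
    define \<phi> :: "'a proj \<Rightarrow> 'a proj" where "\<phi> E = Inf {G. \<forall>S\<in>U. maps_into S E G}" for E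
    have "\<phi> \<in> Hom (Lat (Alg L))"
      unfolding Hom_def \<phi>_def
      by (intro CollectI mono_onI Inf_superset_mono) (auto simp: maps_into_def less_eq_proj_def)
    moreover have "U = {T \<in> BH. \<forall>E\<in>Lat (Alg L). maps_into T E (\<phi> E)}"
    proof (intro equalityI subsetI)
      fix T assume "T \<in> U"
      moreover from this have "T \<in> BH"
        using U' by (auto simp: op_subspace_def)
      ultimately show "T \<in> {T \<in> BH. \<forall>E\<in>Lat (Alg L). maps_into T E (\<phi> E)}"
        unfolding \<phi>_def by (auto intro!: maps_into_Inf)
    next
      fix T assume "T \<in> {T \<in> BH. \<forall>E\<in>Lat (Alg L). maps_into T E (\<phi> E)}"
      then have T: "T \<in> BH" "\<And>E. E \<in> L \<Longrightarrow> maps_into T E (\<phi> E)"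
        using Lat by auto
      show "T \<in> U"
      proof (rule sigma_weak_closed_memI[OF U' cl T(1)])
        fix x y :: "nat \<Rightarrow> 'a"
        assume x: "square_summable x" and y: "square_summable y"
          and ann: "\<And>S. S \<in> U \<Longrightarrow> pairing (\<lambda>n. blinfun_apply S (x n)) y = 0"
        obtain T' where T': "\<And>x y. cinner (blinfun_apply T x) y = cinner x (T' y)"
          "\<And>y. norm (T' y) \<le> norm T * norm y"
          using ex_adjoint[OF T(1)] by blast
        have "annihilates_rank_ones L x (\<lambda>n. T' (y n))"
          unfolding annihilates_rank_ones_def T'(1)[symmetric]
          using right_submodule_annihilator[OF U x y ann] T(2) unfolding \<phi>_def by blast
        then have "pairing x (\<lambda>n. T' (y n)) = 0"
          by (rule core[OF x square_summable_mono[OF y T'(2)]])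
        then show "pairing (\<lambda>n. blinfun_apply T (x n)) y = 0"
          by (simp add: pairing_def T'(1))
      qed
    qed
    ultimately show "\<exists>\<phi>\<in>Hom (Lat (Alg L)). U = {T \<in> BH. \<forall>E\<in>Lat (Alg L). maps_into T E (\<phi> E)}"
      by blast
  next
    fix U assume U: "left_submodule (Alg L) U" and cl: "closedin sigma_weak U"
    have U': "op_subspace U"
      using U by (simp add: left_submodule_def)
    define \<psi> :: "'a proj \<Rightarrow> 'a proj" where "\<psi> E = Sup {G. \<forall>S\<in>U. maps_into S G E}" for E
    have "\<psi> \<in> Hom (Lat (Alg L))"
      unfolding Hom_def \<psi>_def
      by (intro CollectI mono_onI Sup_subset_mono) (auto simp: maps_into_def less_eq_proj_def)
    moreover have "U = {T \<in> BH. \<forall>E\<in>Lat (Alg L). maps_into T (\<psi> E) E}"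
    proof (intro equalityI subsetI)
      fix T assume "T \<in> U"
      moreover from this have "T \<in> BH"
        using U' by (auto simp: op_subspace_def)
      ultimately show "T \<in> {T \<in> BH. \<forall>E\<in>Lat (Alg L). maps_into T (\<psi> E) E}"
        unfolding \<psi>_def by (auto intro!: maps_into_Sup)
    next
      fix T assume "T \<in> {T \<in> BH. \<forall>E\<in>Lat (Alg L). maps_into T (\<psi> E) E}"
      then have T: "T \<in> BH" "\<And>E. E \<in> L \<Longrightarrow> maps_into T (\<psi> E) E"
        using Lat by auto
      show "T \<in> U"
      proof (rule sigma_weak_closed_memI[OF U' cl T(1)])
        fix x y :: "nat \<Rightarrow> 'a"
        assume x: "square_summable x" and y: "square_summable y"
          and ann: "\<And>S. S \<in> U \<Longrightarrow> pairing (\<lambda>n. blinfun_apply S (x n)) y = 0"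
        have "annihilates_rank_ones L (\<lambda>n. blinfun_apply T (x n)) y"
          unfolding annihilates_rank_ones_def
          using left_submodule_annihilator[OF assms(1) U x y ann _ _ _ T(1)]
            T(2)[OF minus_proj_mem[OF assms(1)]] unfolding \<psi>_def by blast
        then show "pairing (\<lambda>n. blinfun_apply T (x n)) y = 0"
          by (rule core[OF square_summable_blinfun[OF x] y])
      qed
    qed
    ultimately show "\<exists>\<psi>\<in>Hom (Lat (Alg L)). U = {T \<in> BH. \<forall>E\<in>Lat (Alg L). maps_into T (\<psi> E) E}"
      by blast
  }
qed

end
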